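(* For every integer $n \ge 1$, \[ \sum_{\pi \in \mathfrak{S}_n(3412,3421)} x^{\operatorname{des}(\pi)} y^{\operatorname{dd}(\pi)} = \sum_{\pi \in \mathfrak{S}_n(2413,3142)} x^{\operatorname{des}(\pi)} y^{\operatorname{dd}(\pi)}. \] Equivalently, the number of $(3412,3421)$-avoiding permutations of $[n]$ with $m$ double descents and $k$ descents equals the number of separable (i.e. $(2413,3142)$-avoiding) permutations of $[n]$ with $m$ double descents and $k$ descents, for all $m,k$.
   Context: For a permutation $\pi$ of $[n]$: $\operatorname{DES}(\pi)=\{i\in[n-1]:\pi(i)>\pi(i+1)\}$, $\operatorname{des}(\pi)=\#\operatorname{DES}(\pi)$; the double descent set is $\operatorname{DD}(\pi)=\{i\in[n] : \pi(i-1)>\pi(i)>\pi(i+1)\}$ with the convention $\pi(0)=\pi(n+1)=\infty$, and $\operatorname{dd}(\pi)=\#\operatorname{DD}(\pi)$. A permutation $\pi$ avoids a pattern $\sigma$ if no (not necessarily consecutive) subsequence of $\pi$ has the same relative order as $\sigma$; $\mathfrak{S}_n(\sigma_1,\dots,\sigma_r)$ denotes the set of permutations of $[n]$ avoiding all of $\sigma_1,\dots,\sigma_r$. *)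

theory Defs
  imports
    "HOL-Combinatorics.Permutations"
    "HOL-Computational_Algebra.Polynomial"
    "HOL-Library.Extended_Nat"
begin

definition DES :: "nat \<Rightarrow> (nat \<Rightarrow> nat) \<Rightarrow> nat set" where
  "DES n \<pi> = {i \<in> {1..<n}. \<pi> i > \<pi> (i + 1)}"

definition des :: "nat \<Rightarrow> (nat \<Rightarrow> nat) \<Rightarrow> nat" where
  "des n \<pi> = card (DES n \<pi>)"

text \<open>The word of a permutation of \<open>{1..n}\<close>, extended by the convention
  \<open>\<pi>(0) = \<pi>(n+1) = \<infinity>\<close>.\<close>

definition bordered :: "nat \<Rightarrow> (nat \<Rightarrow> nat) \<Rightarrow> nat \<Rightarrow> enat" where
  "bordered n \<pi> i = (if i \<in> {1..n} then enat (\<pi> i) else \<infinity>)"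

definition DD :: "nat \<Rightarrow> (nat \<Rightarrow> nat) \<Rightarrow> nat set" where
  "DD n \<pi> = {i \<in> {1..n}. bordered n \<pi> (i - 1) > bordered n \<pi> i
                         \<and> bordered n \<pi> i > bordered n \<pi> (i + 1)}"

definition dd :: "nat \<Rightarrow> (nat \<Rightarrow> nat) \<Rightarrow> nat" where
  "dd n \<pi> = card (DD n \<pi>)"

text \<open>A pattern is given in one-line notation as a list, so its entries are indexed from \<open>0\<close>;
  \<open>f\<close> selects the positions of the occurrence.\<close>

definition contains_pattern :: "nat \<Rightarrow> (nat \<Rightarrow> nat) \<Rightarrow> nat list \<Rightarrow> bool" where
  "contains_pattern n \<pi> \<sigma> \<longleftrightarrow>
     (\<exists>f. strict_mono_on {..<length \<sigma>} f \<and> f ` {..<length \<sigma>} \<subseteq> {1..n} \<and>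
          (\<forall>i<length \<sigma>. \<forall>j<length \<sigma>. \<pi> (f i) < \<pi> (f j) \<longleftrightarrow> \<sigma> ! i < \<sigma> ! j))"

definition avoiders :: "nat \<Rightarrow> nat list set \<Rightarrow> (nat \<Rightarrow> nat) set" where
  "avoiders n \<Sigma> = {\<pi>. \<pi> permutes {1..n} \<and> (\<forall>\<sigma>\<in>\<Sigma>. \<not> contains_pattern n \<pi> \<sigma>)}"

text \<open>The indeterminates \<open>x\<close> and \<open>y\<close> of the bivariate polynomial ring \<open>\<int>[y][x]\<close>.\<close>

definition X :: "int poly poly" where
  "X = [:0, 1:]"

definition Y :: "int poly poly" where
  "Y = [:[:0, 1:]:]"

end

theory Submission
  imports Defs "HOL-Library.Sublist" "HOL-Library.Infinite_Set"
    "HOL-Computational_Algebra.Formal_Power_Series"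
begin

text \<open>Both generating functions, with \<open>z\<close> marking the length, satisfy the cubic
  \<open>F = z + (1 + x y) z F + x z F\<^sup>2 + x F\<^sup>3\<close>, which has a unique power series solution without
  constant term.

  A word \<open>A n B\<close> with maximal letter \<open>n\<close> and smallest letter \<open>b\<close> of \<open>B\<close> avoids 3412 and 3421 iff
  \<open>A b\<close> and \<open>B\<close> do and \<open>A\<close> lies below \<open>B - {b}\<close>. As \<open>A\<close> contributes to the statistics without
  \<open>b\<close>, a second series \<open>T\<close> records the weight of a word with its last letter removed, and
  eliminating \<open>T\<close> from the resulting two quadratic equations leaves the cubic.

  A separable word of length at least two is a direct or a skew sum, uniquely so once the first
  summand is required to be indecomposable. Whether the letters at the seam are double descents
  depends only on the kind of sum, so the four series for the possible boundary conditions
  satisfy a closed system, and it too reduces to the cubic.\<close>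

section \<open>Words and pattern occurrences\<close>

text \<open>The word A n B cannot be rebuilt from the patterns of A and B alone: the letters of A
  together with b form an initial interval, but the place of b among them is free. That place is
  recorded in A b, so b is counted in both halves, and the recursion runs over words A b although
  only A contributes to the statistics there. On the separable side, the seam is always a descent in
  a skew sum and never one in a direct sum. A summand can therefore meet any of four situations, a
  larger letter before it or not and a smaller letter after it or not, but nothing finer. No
  bijection between the two classes is constructed. The coefficients form an integral domain, so
  common factors may be cancelled, and two solutions of the cubic agree because their difference is
  annihilated by a series with constant term 1.\<close>

definition occurs :: "('a \<Rightarrow> 'a \<Rightarrow> 'a \<Rightarrow> 'a \<Rightarrow> bool) \<Rightarrow> 'a list \<Rightarrow> bool" where
  "occurs R xs \<longleftrightarrow> (\<exists>a b c d. subseq [a, b, c, d] xs \<and> R a b c d)"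

lemma subseq_map_iff: "subseq ys (map f xs) \<longleftrightarrow> (\<exists>zs. subseq zs xs \<and> ys = map f zs)"
  by (auto simp: subseq_conv_nths nths_map)

lemma subseq_set: "subseq xs ys \<Longrightarrow> set xs \<subseteq> set ys"
  by (auto elim: list_emb_set)

lemma occursI: "subseq [a, b, c, d] xs \<Longrightarrow> R a b c d \<Longrightarrow> occurs R xs"
  unfolding occurs_def by (intro exI conjI)

lemma occursE:
  assumes "occurs R xs"
  obtains a b c d where "subseq [a, b, c, d] xs" "R a b c d"
  using assms unfolding occurs_def by (elim exE conjE)

lemma occurs_mono: "occurs R xs \<Longrightarrow> subseq xs ys \<Longrightarrow> occurs R ys"
  by (elim occursE, rule occursI) (rule subseq_order.trans)

lemma subseq4_mapE:
  assumes "subseq [a, b, c, d] (map g xs)"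
  obtains a' b' c' d' where "subseq [a', b', c', d'] xs" "a = g a'" "b = g b'" "c = g c'" "d = g d'"
proof -
  obtain zs where zs: "subseq zs xs" "map g zs = [a, b, c, d]"
    using assms unfolding subseq_map_iff by metis
  then show thesis
    using that unfolding map_eq_Cons_conv by auto
qed

lemma occurs_map:
  assumes "\<And>a b c d. {a, b, c, d} \<subseteq> set xs \<Longrightarrow> R (g a) (g b) (g c) (g d) \<longleftrightarrow> S a b c d"
  shows "occurs R (map g xs) \<longleftrightarrow> occurs S xs"
proof -
  have RS: "R (g a) (g b) (g c) (g d) \<longleftrightarrow> S a b c d" if "subseq [a, b, c, d] xs" for a b c d
    using subseq_set[OF that] assms by simp
  show ?thesis
  proof
    assume "occurs R (map g xs)"
    then obtain a b c d where *: "subseq [a, b, c, d] (map g xs)" "R a b c d"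
      by (rule occursE)
    then obtain a' b' c' d' where "subseq [a', b', c', d'] xs" "R (g a') (g b') (g c') (g d')"
      by (metis subseq4_mapE[OF *(1)])
    then show "occurs S xs"
      using RS[of a' b' c' d'] by (intro occursI) auto
  next
    assume "occurs S xs"
    then obtain a b c d where *: "subseq [a, b, c, d] xs" "S a b c d"
      by (rule occursE)
    have "subseq (map g [a, b, c, d]) (map g xs)"
      using *(1) by (rule subseq_map)
    then show "occurs R (map g xs)"
      using RS[OF *(1)] *(2) by (intro occursI) auto
  qed
qed
lemma sorted_wrt_subseq: "subseq xs ys \<Longrightarrow> sorted_wrt P ys \<Longrightarrow> sorted_wrt P xs"
  by (induction rule: list_emb.induct) (auto dest: subseq_set)

lemma subseq4_append_cases:
  assumes "subseq [a, b, c, d] (xs @ ys)"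
  obtains "subseq [a, b, c, d] xs"
    | "subseq [a, b, c] xs" "d \<in> set ys"
    | "subseq [a, b] xs" "subseq [c, d] ys"
    | "a \<in> set xs" "subseq [b, c, d] ys"
    | "subseq [a, b, c, d] ys"
  using assms by (auto simp: subseq_append_iff Cons_eq_append_conv subseq_singleton_left)

text \<open>Leaving the order of \<open>c\<close> and \<open>d\<close> open merges both patterns
  into one condition; it admits in addition only ties, which do not occur in distinct words.\<close>

definition has_3412_3421 :: "'a::linorder list \<Rightarrow> bool" where
  "has_3412_3421 = occurs (\<lambda>a b c d. a < b \<and> c < a \<and> d < a)"

definition has_2413_3142 :: "'a::linorder list \<Rightarrow> bool" where
  "has_2413_3142 = occurs (\<lambda>a b c d. c < a \<and> a < d \<and> d < b \<or> b < d \<and> d < a \<and> a < c)"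

lemma has_3412_3421_map:
  "strict_mono_on (set xs) g \<Longrightarrow> has_3412_3421 (map g xs) \<longleftrightarrow> has_3412_3421 xs"
  unfolding has_3412_3421_def by (rule occurs_map) (simp add: strict_mono_on_less)

lemma has_2413_3142_map:
  "strict_mono_on (set xs) g \<Longrightarrow> has_2413_3142 (map g xs) \<longleftrightarrow> has_2413_3142 xs"
  unfolding has_2413_3142_def by (rule occurs_map) (simp add: strict_mono_on_less)

section \<open>Pattern containment in a permutation as an occurrence in its word\<close>

definition word :: "nat \<Rightarrow> (nat \<Rightarrow> 'a) \<Rightarrow> 'a list" where
  "word n \<pi> = map \<pi> [1..<Suc n]"

lemma subseq4_upt_iff:
  "subseq [i, j, k, l] [1..<Suc n] \<longleftrightarrow> 1 \<le> i \<and> i < j \<and> j < k \<and> k < l \<and> l \<le> n"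
proof
  assume *: "subseq [i, j, k, l] [1..<Suc n]"
  have "sorted_wrt (<) [i, j, k, l]"
    using * by (rule sorted_wrt_subseq) (rule sorted_wrt_upt)
  then show "1 \<le> i \<and> i < j \<and> j < k \<and> k < l \<and> l \<le> n"
    using subseq_set[OF *] by auto
next
  assume "1 \<le> i \<and> i < j \<and> j < k \<and> k < l \<and> l \<le> n"
  then show "subseq [i, j, k, l] [1..<Suc n]"
    by (intro sorted_subset_imp_subseq) (auto simp del: upt_Suc)
qed

lemma contains_pattern_iff_occurs:
  "contains_pattern n \<pi> [p, q, r, s] \<longleftrightarrow>
     occurs (\<lambda>a b c d. \<forall>i<4. \<forall>j<4. [a, b, c, d] ! i < [a, b, c, d] ! j \<longleftrightarrow> [p, q, r, s] ! i < [p, q, r, s] ! j)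
       (word n \<pi>)" (is "?L \<longleftrightarrow> occurs ?R _")
proof -
  have len: "length [p, q, r, s] = 4" by simp
  show ?thesis
  proof
    assume ?L
    then obtain f where f: "strict_mono_on {..<4} f" "f ` {..<4} \<subseteq> {1..n}"
      "\<forall>i<4. \<forall>j<4. \<pi> (f i) < \<pi> (f j) \<longleftrightarrow> [p, q, r, s] ! i < [p, q, r, s] ! j"
      unfolding contains_pattern_def len by blast
    have "f 0 < f 1" "f 1 < f 2" "f 2 < f 3"
      using f(1) by (auto simp: strict_mono_on_def)
    moreover have "1 \<le> f 0" "f 3 \<le> n"
      using f(2) by (auto simp: image_subset_iff)
    ultimately have "subseq [f 0, f 1, f 2, f 3] [1..<Suc n]"
      unfolding subseq4_upt_iff by blast
    then have "subseq (map \<pi> [f 0, f 1, f 2, f 3]) (word n \<pi>)"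
      unfolding word_def by (rule subseq_map)
    moreover have "?R (\<pi> (f 0)) (\<pi> (f 1)) (\<pi> (f 2)) (\<pi> (f 3))"
      using f(3) by (simp add: numeral_eq_Suc All_less_Suc)
    ultimately show "occurs ?R (word n \<pi>)"
      by (intro occursI) simp_all
  next
    assume "occurs ?R (word n \<pi>)"
    then obtain a b c d where "subseq [a, b, c, d] (word n \<pi>)" and R: "?R a b c d"
      by (rule occursE)
    from this(1) obtain i j k l where "subseq [i, j, k, l] [1..<Suc n]" and
      **: "a = \<pi> i" "b = \<pi> j" "c = \<pi> k" "d = \<pi> l"
      unfolding word_def by (rule subseq4_mapE)
    then have *: "1 \<le> i" "i < j" "j < k" "k < l" "l \<le> n"
      unfolding subseq4_upt_iff by auto
    have "strict_mono_on {..<4} ((!) [i, j, k, l])"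
      using * by (auto simp: strict_mono_on_def numeral_eq_Suc less_Suc_eq)
    moreover have "(!) [i, j, k, l] ` {..<4} \<subseteq> {1..n}"
      using * by (auto simp: numeral_eq_Suc less_Suc_eq)
    moreover have "\<forall>u<4. \<forall>v<4. \<pi> ([i, j, k, l] ! u) < \<pi> ([i, j, k, l] ! v) \<longleftrightarrow> [p, q, r, s] ! u < [p, q, r, s] ! v"
      using R unfolding ** by (simp add: numeral_eq_Suc All_less_Suc)
    ultimately show ?L
      unfolding contains_pattern_def len by blast
  qed
qed

lemma occurs_disj: "occurs (\<lambda>a b c d. R a b c d \<or> S a b c d) xs \<longleftrightarrow> occurs R xs \<or> occurs S xs"
  unfolding occurs_def by blast

lemma occurs_cong_distinct:
  assumes "distinct xs"
    and "\<And>a b c d. distinct [a, b, c, d] \<Longrightarrow> R a b c d \<longleftrightarrow> S a b c d"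
  shows "occurs R xs \<longleftrightarrow> occurs S xs"
proof -
  have "distinct [a, b, c, d]" if "subseq [a, b, c, d] xs" for a b c d
    using that assms(1) unfolding subseq_conv_nths by (metis distinct_nthsI)
  then have "R a b c d \<longleftrightarrow> S a b c d" if "subseq [a, b, c, d] xs" for a b c d
    using that assms(2) by blast
  then show ?thesis
    unfolding occurs_def by (metis (no_types))
qed

lemma all_less_4: "(\<forall>i<4. P i) \<longleftrightarrow> P 0 \<and> P 1 \<and> P 2 \<and> P (3::nat)"
  by (auto simp: numeral_eq_Suc All_less_Suc)

lemma pattern_3412: 
  "(\<forall>i<4. \<forall>j<4. [a, b, c, d] ! i < [a, b, c, d] ! j \<longleftrightarrow> [3, 4, 1, 2::nat] ! i < [3, 4, 1, 2] ! j) \<longleftrightarrow> c < d \<and> d < a \<and> a < (b::nat)"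
  by (simp add: all_less_4) linarith
lemma pattern_3421: 
  "(\<forall>i<4. \<forall>j<4. [a, b, c, d] ! i < [a, b, c, d] ! j \<longleftrightarrow> [3, 4, 2, 1::nat] ! i < [3, 4, 2, 1] ! j) \<longleftrightarrow> d < c \<and> c < a \<and> a < (b::nat)"
  by (simp add: all_less_4) linarith
lemma pattern_2413: 
  "(\<forall>i<4. \<forall>j<4. [a, b, c, d] ! i < [a, b, c, d] ! j \<longleftrightarrow> [2, 4, 1, 3::nat] ! i < [2, 4, 1, 3] ! j) \<longleftrightarrow> c < a \<and> a < d \<and> d < (b::nat)"
  by (simp add: all_less_4) linarith
lemma pattern_3142: 
  "(\<forall>i<4. \<forall>j<4. [a, b, c, d] ! i < [a, b, c, d] ! j \<longleftrightarrow> [3, 1, 4, 2::nat] ! i < [3, 1, 4, 2] ! j) \<longleftrightarrow> b < d \<and> d < a \<and> a < (c::nat)"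
  by (simp add: all_less_4) linarith
lemma avoids_3412_3421_iff:
  fixes \<pi> :: "nat \<Rightarrow> nat"
  assumes "distinct (word n \<pi>)"
  shows "(\<forall>\<sigma>\<in>{[3,4,1,2], [3,4,2,1]}. \<not> contains_pattern n \<pi> \<sigma>) \<longleftrightarrow> \<not> has_3412_3421 (word n \<pi>)"
proof -
  have "contains_pattern n \<pi> [3,4,1,2] \<or> contains_pattern n \<pi> [3,4,2,1] \<longleftrightarrow> has_3412_3421 (word n \<pi>)"
    unfolding contains_pattern_iff_occurs has_3412_3421_def occurs_disj[symmetric]
      pattern_3412 pattern_3421
    by (rule occurs_cong_distinct[OF assms]) auto
  then show ?thesis by blast
qed

lemma avoids_2413_3142_iff:
  fixes \<pi> :: "nat \<Rightarrow> nat"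
  shows "(\<forall>\<sigma>\<in>{[2,4,1,3], [3,1,4,2]}. \<not> contains_pattern n \<pi> \<sigma>) \<longleftrightarrow> \<not> has_2413_3142 (word n \<pi>)"
proof -
  have "contains_pattern n \<pi> [2,4,1,3] \<or> contains_pattern n \<pi> [3,1,4,2] \<longleftrightarrow> has_2413_3142 (word n \<pi>)"
    unfolding contains_pattern_iff_occurs has_2413_3142_def occurs_disj[symmetric]
      pattern_2413 pattern_3142 ..
  then show ?thesis by blast
qed

section \<open>The weight of a word\<close>

text \<open>The flags say whether the word is preceded, respectively followed, by a larger,
  respectively smaller, letter; a permutation bordered by \<open>\<infinity>\<close> has flags
  \<open>True\<close> and \<open>False\<close>.\<close>

fun weight :: "bool \<Rightarrow> 'a::linorder list \<Rightarrow> bool \<Rightarrow> int poly poly" where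
  "weight l [] r = 1"
| "weight l [a] r = (if l \<and> r then Y else 1)"
| "weight l (a # b # xs) r =
     (if b < a then X * (if l then Y else 1) * weight True (b # xs) r else weight False (b # xs) r)"

text \<open>The only descent that lies in neither word is the one at the seam. It contributes its
  own \<open>X\<close> and settles both the right flag of \<open>xs\<close> and the left flag of
  \<open>ys\<close>.\<close>

lemma weight_append:
  "xs \<noteq> [] \<Longrightarrow> ys \<noteq> [] \<Longrightarrow>
   weight l (xs @ ys) r =
     (let d = hd ys < last xs in weight l xs d * (if d then X else 1) * weight d ys r)"
\<comment> \<open>\<open>True\<close> is a mere placeholder for the last argument of the rule: the
  recursion never changes the right flag, and the right flag of \<open>xs\<close> in the goal is
  determined by the seam.\<close>
proof (induction l xs d\<equiv>True rule: weight.induct)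
  case (2 l a)
  then show ?case by (cases ys) (auto simp: Let_def)
qed (auto simp: Let_def)

lemma weight_map: "strict_mono_on (set xs) g \<Longrightarrow> weight l (map g xs) r = weight l xs r"
proof (induction l xs r rule: weight.induct)
  case (3 l a b xs r)
  have "strict_mono_on (set (b # xs)) g"
    by (rule monotone_on_subset[OF "3.prems"]) auto
  with 3 show ?case by (simp add: strict_mono_on_less)
qed auto

text \<open>Replaces the left-to-right recursion by one factor per position, so that exponents can
  be counted. At the two ends the flags stand in for the missing neighbours.\<close>

lemma weight_eq_prod:
  "xs \<noteq> [] \<Longrightarrow> weight l xs r =
    (\<Prod>i<length xs. if Suc i < length xs \<and> xs ! Suc i < xs ! i then X else 1) *
    (\<Prod>i<length xs. if (if i = 0 then l else xs ! i < xs ! (i - 1)) \<and>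
       (if Suc i < length xs then xs ! Suc i < xs ! i else r) then Y else 1)"
proof (induction l xs r rule: weight.induct)
  case (3 l a b xs r)
  define f where "f i = (if Suc i < length (a # b # xs) \<and> (a # b # xs) ! Suc i < (a # b # xs) ! i
    then X else 1)" for i
  define g where "g i = (if (if i = 0 then l else (a # b # xs) ! i < (a # b # xs) ! (i - 1)) \<and>
    (if Suc i < length (a # b # xs) then (a # b # xs) ! Suc i < (a # b # xs) ! i else r)
    then Y else 1)" for i
  have shift: "prod h {..<length (a # b # xs)} = h 0 * (\<Prod>i<length (b # xs). h (Suc i))"
    for h :: "nat \<Rightarrow> int poly poly"
    unfolding length_Cons[of a] by (rule prod.lessThan_Suc_shift)
  have "weight (b < a) (b # xs) r =
    (\<Prod>i<length (b # xs). if Suc i < length (b # xs) \<and> (b # xs) ! Suc i < (b # xs) ! i then X else 1) *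
    (\<Prod>i<length (b # xs). if (if i = 0 then b < a else (b # xs) ! i < (b # xs) ! (i - 1)) \<and>
       (if Suc i < length (b # xs) then (b # xs) ! Suc i < (b # xs) ! i else r) then Y else 1)"
    using 3 by (cases "b < a") (simp_all only: simp_thms list.simps)
  also have "\<dots> = (\<Prod>i<length (b # xs). f (Suc i)) * (\<Prod>i<length (b # xs). g (Suc i))"
    by (intro arg_cong2[where f = "(*)"] prod.cong) (auto simp: f_def g_def nth_Cons')
  finally have tail: "weight (b < a) (b # xs) r =
    (\<Prod>i<length (b # xs). f (Suc i)) * (\<Prod>i<length (b # xs). g (Suc i))" .
  have "weight l (a # b # xs) r = (f 0 * g 0) * weight (b < a) (b # xs) r"
    by (simp add: f_def g_def)
  then have "weight l (a # b # xs) r = prod f {..<length (a # b # xs)} * prod g {..<length (a # b # xs)}"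
    unfolding shift tail by (simp only: mult_ac)
  then show ?case
    unfolding f_def g_def .
qed auto

lemma prod_if_power:
  fixes z :: "'b::comm_monoid_mult"
  shows "finite A \<Longrightarrow> (\<Prod>i\<in>A. if P i then z else 1) = z ^ card {i \<in> A. P i}"
  by (simp add: prod.If_cases Int_def)

lemma weight_word:
  assumes "n \<ge> 1"
  shows "weight True (word n \<pi>) False = X ^ des n \<pi> * Y ^ dd n \<pi>"
proof -
  have len: "length (word n \<pi>) = n"
    and nth: "\<And>i. i < n \<Longrightarrow> word n \<pi> ! i = \<pi> (Suc i)"
    by (simp_all add: word_def del: upt_Suc)
  have ne: "word n \<pi> \<noteq> []"
    using assms len by force
  \<comment> \<open>\<open>DES\<close> and \<open>DD\<close> number positions from 1, lists from 0;
    hence the image under \<open>Suc\<close>.\<close>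
  have "DES n \<pi> = Suc ` {i \<in> {..<n}. Suc i < n \<and> word n \<pi> ! Suc i < word n \<pi> ! i}"
  proof (intro set_eqI iffI)
    fix i assume "i \<in> DES n \<pi>"
    then show "i \<in> Suc ` {i \<in> {..<n}. Suc i < n \<and> word n \<pi> ! Suc i < word n \<pi> ! i}"
      by (intro image_eqI[of _ _ "i - 1"]) (auto simp: DES_def nth)
  qed (auto simp: DES_def nth)
  then have des: "des n \<pi> = card {i \<in> {..<n}. Suc i < n \<and> word n \<pi> ! Suc i < word n \<pi> ! i}"
    unfolding des_def by (simp add: card_image)
  have "DD n \<pi> = Suc ` {i \<in> {..<n}. (if i = 0 then True else word n \<pi> ! i < word n \<pi> ! (i - 1)) \<and>
       (if Suc i < n then word n \<pi> ! Suc i < word n \<pi> ! i else False)}" (is "_ = Suc ` ?A")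
  proof (intro set_eqI iffI)
    fix i assume "i \<in> DD n \<pi>"
    then show "i \<in> Suc ` ?A"
      by (cases i; cases "i - 1") (auto simp: DD_def bordered_def nth split: if_splits)
  qed (auto simp: DD_def bordered_def nth split: if_splits)
  then have dd: "dd n \<pi> = card ?A"
    unfolding dd_def by (simp add: card_image)
  show ?thesis
    unfolding weight_eq_prod[OF ne] len des dd by (simp only: prod_if_power finite_lessThan)
qed

section \<open>Arrangements of a finite set\<close>

definition arrangements :: "('a list \<Rightarrow> bool) \<Rightarrow> 'a set \<Rightarrow> 'a list set" where
  "arrangements P A = {xs. distinct xs \<and> set xs = A \<and> P xs}"

lemma finite_arrangements [simp]: "finite A \<Longrightarrow> finite (arrangements P A)"
  by (rule finite_subset[OF _ finite_subset_distinct[of A]]) (auto simp: arrangements_def)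

lemma length_arrangements: "xs \<in> arrangements P A \<Longrightarrow> length xs = card A"
  by (auto simp: arrangements_def distinct_card)

text \<open>Standardisation: the increasing bijection from \<open>{..<card A}\<close> to
  \<open>A\<close> relabels the words. It allows the pieces of a decomposition to be summed knowing
  only their lengths.\<close>

lemma sum_arrangements_card:
  fixes A :: "nat set"
  assumes "finite A"
    and P: "\<And>g xs. strict_mono_on (set xs) g \<Longrightarrow> P (map g xs) \<longleftrightarrow> P xs"
    and f: "\<And>g xs. strict_mono_on (set xs) g \<Longrightarrow> f (map g xs) = f xs"
  shows "sum f (arrangements P A) = sum f (arrangements P {..<card A})"
proof -
  obtain h where h: "bij_betw h {..<card A} A" "strict_mono_on {..<card A} h"
    using ex_bij_betw_strict_mono_card[OF \<open>finite A\<close>] .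
  have inj: "inj_on h {..<card A}" and im: "h ` {..<card A} = A"
    using h(1) by (auto simp: bij_betw_def)
  have mono: "strict_mono_on (set xs) h" if "set xs \<subseteq> {..<card A}" for xs
    using monotone_on_subset[OF h(2) that] .
  have "bij_betw (map h) (arrangements P {..<card A}) (arrangements P A)"
  proof (rule bij_betwI')
    fix xs ys assume "xs \<in> arrangements P {..<card A}" "ys \<in> arrangements P {..<card A}"
    then show "(map h xs = map h ys) \<longleftrightarrow> xs = ys"
      using inj by (intro inj_on_map_eq_map) (simp add: arrangements_def)
  next
    fix xs assume "xs \<in> arrangements P {..<card A}"
    then show "map h xs \<in> arrangements P A"
      using inj im P[of xs h] mono[of xs] by (auto simp: arrangements_def distinct_map)
  next
    fix ys assume ys: "ys \<in> arrangements P A"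
    then have "ys \<in> lists (h ` {..<card A})"
      by (auto simp: arrangements_def im)
    then obtain xs where xs: "ys = map h xs" "xs \<in> lists {..<card A}"
      unfolding lists_image by auto
    have sub: "set xs \<subseteq> {..<card A}"
      using xs(2) by auto
    have "h ` set xs = h ` {..<card A}"
      using ys by (simp add: arrangements_def xs(1) im)
    then have "set xs = {..<card A}"
      using inj_on_image_eq_iff[OF inj sub] by simp
    then have "xs \<in> arrangements P {..<card A}"
      using ys P[OF mono[OF sub]] unfolding xs(1) by (auto simp: arrangements_def distinct_map)
    then show "\<exists>xs\<in>arrangements P {..<card A}. ys = map h xs"
      using xs(1) by blast
  qed
  then have "sum f (arrangements P A) = (\<Sum>xs\<in>arrangements P {..<card A}. f (map h xs))"
    by (simp add: sum.reindex_bij_betw)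
  also have "\<dots> = sum f (arrangements P {..<card A})"
    by (intro sum.cong refl f mono) (auto simp: arrangements_def)
  finally show ?thesis .
qed

lemma bij_betw_word:
  "bij_betw (word n) {\<pi>. \<pi> permutes {1..n}} {xs. distinct xs \<and> set xs = {1..n}}"
proof (rule bij_betwI')
  fix \<pi> \<rho> :: "nat \<Rightarrow> nat"
  assume *: "\<pi> \<in> {\<pi>. \<pi> permutes {1..n}}" "\<rho> \<in> {\<pi>. \<pi> permutes {1..n}}"
  show "(word n \<pi> = word n \<rho>) \<longleftrightarrow> \<pi> = \<rho>"
  proof
    assume "word n \<pi> = word n \<rho>"
    then have "\<pi> i = \<rho> i" if "i \<in> {1..n}" for i
      using that by (auto simp: word_def simp del: upt_Suc)
    moreover have "\<pi> i = \<rho> i" if "i \<notin> {1..n}" for i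
      using that * by (simp add: permutes_def)
    ultimately show "\<pi> = \<rho>" by blast
  qed simp
next
  fix \<pi> :: "nat \<Rightarrow> nat"
  assume "\<pi> \<in> {\<pi>. \<pi> permutes {1..n}}"
  then have *: "\<pi> permutes {1..n}" by simp
  have "{1..<Suc n} = {1..n}" by auto
  then show "word n \<pi> \<in> {xs. distinct xs \<and> set xs = {1..n}}"
    using permutes_image[OF *] permutes_inj_on[OF *]
    by (simp add: word_def distinct_map del: upt_Suc)
next
  fix xs :: "nat list"
  assume "xs \<in> {xs. distinct xs \<and> set xs = {1..n}}"
  then have xs: "distinct xs" "set xs = {1..n}" by auto
  then have len: "length xs = n"
    using distinct_card by fastforce
  define \<pi> where "\<pi> i = (if i \<in> {1..n} then xs ! (i - 1) else i)" for i
  have w: "word n \<pi> = xs"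
    by (rule nth_equalityI) (auto simp: word_def len \<pi>_def simp del: upt_Suc)
  have "inj_on \<pi> {1..n}"
    using xs(1) len by (intro inj_onI) (auto simp: \<pi>_def nth_eq_iff_index_eq)
  moreover have "\<pi> ` {1..n} = {1..n}"
  proof -
    have "set (word n \<pi>) = \<pi> ` {1..n}"
      by (auto simp: word_def simp del: upt_Suc)
    then show ?thesis using w xs(2) by simp
  qed
  ultimately have "\<pi> permutes {1..n}"
    by (intro bij_imp_permutes) (auto simp: bij_betw_def \<pi>_def)
  then show "\<exists>\<pi>\<in>{\<pi>. \<pi> permutes {1..n}}. xs = word n \<pi>"
    using w by blast
qed

lemma sum_avoiders_eq_arrangements:
  assumes "n \<ge> 1"
    and avoid: "\<And>\<pi>. distinct (word n \<pi>) \<Longrightarrow> (\<forall>\<sigma>\<in>\<Sigma>. \<not> contains_pattern n \<pi> \<sigma>) \<longleftrightarrow> P (word n \<pi>)"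
    and P: "\<And>g xs. strict_mono_on (set xs) g \<Longrightarrow> P (map g xs) \<longleftrightarrow> P xs"
  shows "(\<Sum>\<pi>\<in>avoiders n \<Sigma>. X ^ des n \<pi> * Y ^ dd n \<pi>)
    = (\<Sum>xs\<in>arrangements P {..<n}. weight True xs False)"
proof -
  have d: "distinct (word n \<pi>)" if "\<pi> permutes {1..n}" for \<pi> :: "nat \<Rightarrow> nat"
    using bij_betwE[OF bij_betw_word[of n]] that by auto
  have "avoiders n \<Sigma> = {\<pi> \<in> {\<pi>. \<pi> permutes {1..n}}. P (word n \<pi>)}"
    unfolding avoiders_def using avoid d by blast
  moreover have "bij_betw (word n) {\<pi> \<in> {\<pi>. \<pi> permutes {1..n}}. P (word n \<pi>)} (arrangements P {1..n})"
  proof -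
    have "arrangements P {1..n} = {xs \<in> word n ` {\<pi>. \<pi> permutes {1..n}}. P xs}"
      unfolding arrangements_def bij_betw_imp_surj_on[OF bij_betw_word[of n]] by auto
    also have "\<dots> = word n ` {\<pi> \<in> {\<pi>. \<pi> permutes {1..n}}. P (word n \<pi>)}"
      by auto
    finally have "arrangements P {1..n} = word n ` {\<pi> \<in> {\<pi>. \<pi> permutes {1..n}}. P (word n \<pi>)}" .
    then show ?thesis
      by (intro bij_betw_subset[OF bij_betw_word[of n]]) auto
  qed
  ultimately have "(\<Sum>\<pi>\<in>avoiders n \<Sigma>. weight True (word n \<pi>) False)
      = (\<Sum>xs\<in>arrangements P {1..n}. weight True xs False)"
    using sum.reindex_bij_betw by fastforce
  \<comment> \<open>The letters 1 to n become 0 to n - 1, the form in which all recurrences below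
    are stated.\<close>
  also have "\<dots> = (\<Sum>xs\<in>arrangements P {..<card {1..n}}. weight True xs False)"
    by (rule sum_arrangements_card[OF _ P]) (simp_all add: weight_map)
  finally show ?thesis
    using weight_word[OF assms(1)] by simp
qed

section \<open>Words avoiding 3412 and 3421\<close>

lemma lower_set_partition:
  fixes I J :: "nat set"
  assumes "I \<union> J = {..<n}" and less: "\<forall>i\<in>I. \<forall>j\<in>J. i < j"
  shows "I = {..<card I}" "J = {card I..<n}"
proof -
  have "\<exists>k. I = {..<k}"
  proof (cases "I = {}")
    case False
    have fin: "finite I"
      using assms(1) by (metis finite_Un finite_lessThan)
    have "i \<in> I" if "i \<le> Max I" for i
    proof -
      have "Max I \<in> I" using Max_in[OF fin False] .
      moreover from this have "Max I \<in> {..<n}" using assms(1) by blast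
      then have "i \<in> I \<union> J" using assms(1) that by simp
      ultimately show ?thesis using less that by fastforce
    qed
    then have "i \<in> I \<longleftrightarrow> i \<in> {..<Suc (Max I)}" for i
      using Max_ge[OF fin, of i] by (auto simp only: less_Suc_eq_le lessThan_iff)
    then have "I = {..<Suc (Max I)}"
      by (rule set_eqI)
    then show ?thesis ..
  next
    case True
    then have "I = {..<0}" by simp
    then show ?thesis ..
  qed
  then obtain k where k: "I = {..<k}" ..
  have "J \<inter> I = {}"
    using less by fastforce
  then have "J = {..<n} - {..<k}"
    using assms(1) k by blast
  with k show "I = {..<card I}" "J = {card I..<n}"
    by auto
qed

lemma subseq_pair_cases:
  assumes "b \<in> set xs" "c \<in> set xs" "b \<noteq> c"
  shows "subseq [b, c] xs \<or> subseq [c, b] xs"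
  using assms by (induction xs) (auto simp: subseq_singleton_left)

lemma has_3412_3421I:
  "subseq [a, b, c, d] xs \<Longrightarrow> a < b \<Longrightarrow> c < a \<Longrightarrow> d < a \<Longrightarrow> has_3412_3421 xs"
  unfolding has_3412_3421_def by (intro occursI conjI)

lemma has_3412_3421E:
  assumes "has_3412_3421 xs"
  obtains a b c d where "subseq [a, b, c, d] xs" "a < b" "c < a" "d < a"
  using assms unfolding has_3412_3421_def by (elim occursE conjE)

lemma has_3412_3421_mono: "has_3412_3421 xs \<Longrightarrow> subseq xs ys \<Longrightarrow> has_3412_3421 ys"
  unfolding has_3412_3421_def by (rule occurs_mono)

text \<open>If some a in \<open>as\<close> exceeded a letter c of \<open>bs\<close> other than
  \<open>b\<close>, then a, \<open>m\<close> followed by \<open>b\<close> and c in either order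
  would be forbidden. Conversely, let an occurrence start in \<open>as\<close>. By the third
  condition the only letter after \<open>as\<close> that is smaller than its first letter is
  \<open>b\<close>. So its last two letters cannot both lie there, and if only the last one does, it
  is \<open>b\<close> and the occurrence already lies in \<open>as @ [b]\<close>. An occurrence
  starting after \<open>as\<close> cannot start with the maximum, so it lies in
  \<open>bs\<close>.\<close>

lemma not_has_3412_3421_split_iff:
  fixes b m :: "'a::linorder"
  assumes dist: "distinct (as @ m # bs)" and m: "\<And>x. x \<in> set as \<union> set bs \<Longrightarrow> x < m"
    and b: "b \<in> set bs" "\<And>x. x \<in> set bs \<Longrightarrow> b \<le> x"
  shows "\<not> has_3412_3421 (as @ m # bs) \<longleftrightarrow>
    \<not> has_3412_3421 (as @ [b]) \<and> \<not> has_3412_3421 bs \<and> (\<forall>a\<in>set as. \<forall>c\<in>set bs - {b}. a < c)"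
    (is "_ \<longleftrightarrow> ?R")
proof
  assume *: "\<not> has_3412_3421 (as @ m # bs)"
  have "subseq (as @ [b]) (as @ m # bs)"
    using b(1) by (intro list_emb_append_mono) (simp_all add: subseq_singleton_left)
  then have "\<not> has_3412_3421 (as @ [b])"
    using * has_3412_3421_mono by blast
  moreover have "subseq bs (as @ m # bs)"
    by (intro subseq_drop_many list_emb_Cons) simp
  then have "\<not> has_3412_3421 bs"
    using * has_3412_3421_mono by blast
  moreover have "a < c" if "a \<in> set as" "c \<in> set bs - {b}" for a c
  proof (rule ccontr)
    assume "\<not> a < c"
    with that dist have "c < a" by (cases a c rule: linorder_cases) auto
    have sub: "subseq [a, m, u, v] (as @ m # bs)" if "subseq [u, v] bs" for u v
      using list_emb_append_mono[of "(=)" "[a]" as "[m, u, v]" "m # bs"] that \<open>a \<in> set as\<close>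
      by (simp add: subseq_singleton_left)
    have "b < a" "a < m"
      using b(2)[of c] m[of a] that \<open>c < a\<close> by auto
    then have "\<not> subseq [b, c] bs" "\<not> subseq [c, b] bs"
      using has_3412_3421I[OF sub] * \<open>c < a\<close> by blast+
    then show False
      using subseq_pair_cases[of b bs c] that b(1) by blast
  qed
  ultimately show ?R by blast
next
  assume R: ?R
  show "\<not> has_3412_3421 (as @ m # bs)"
  proof
    assume "has_3412_3421 (as @ m # bs)"
    then obtain p q r s where sub: "subseq [p, q, r, s] (as @ m # bs)"
      and less: "p < q" "r < p" "s < p"
      by (rule has_3412_3421E)
    have R1: "\<not> subseq [p, q, r, s] (as @ [b])" and R2: "\<not> subseq [p, q, r, s] bs"
      using R less has_3412_3421I by blast+
    have later: "x = b" if "p \<in> set as" "x \<in> set (m # bs)" "x < p" for x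
    proof (rule ccontr)
      assume "x \<noteq> b"
      have "p < m" using m[of p] that by simp
      with \<open>x \<noteq> b\<close> have "x \<in> set bs - {b}" using that by auto
      then have "p < x" using R that by blast
      with that show False by simp
    qed
    have "distinct (m # bs)"
      using dist by simp
    have pair: "\<not> (p \<in> set as \<and> subseq [r, s] (m # bs))"
    proof
      assume *: "p \<in> set as \<and> subseq [r, s] (m # bs)"
      then have "r \<in> set (m # bs)" "s \<in> set (m # bs)"
        using subseq_set by fastforce+
      then have "r = b" "s = b"
        using later * less by blast+
      moreover have "r \<noteq> s"
        using * \<open>distinct (m # bs)\<close> by (metis distinct_length_2_or_more distinct_nthsI subseq_conv_nths)
      ultimately show False by simp
    qed
    from sub show False
    proof (cases rule: subseq4_append_cases)
      case 1
      then show False using R1 by (auto intro: subseq_rev_drop_many)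
    next
      case 2
      then have "p \<in> set as" using subseq_set by fastforce
      then have "s = b" using later 2 less by blast
      then show False
        using R1 list_emb_append_mono[OF 2(1), of "[s]" "[b]"] by simp
    next
      case 3
      then have "p \<in> set as" using subseq_set by fastforce
      with 3 pair show False by blast
    next
      case 4
      then have "subseq [r, s] (m # bs)" by (meson subseq_Cons')
      with 4 pair show False by blast
    next
      case 5
      have "p \<noteq> m"
      proof
        assume "p = m"
        have "q \<in> set (m # bs)" using subseq_set[OF 5] by simp
        then show False using m[of q] less \<open>p = m\<close> by auto
      qed
      then show False using 5 R2 by auto
    qed
  qed
qed

definition av :: "nat list \<Rightarrow> bool" where
  "av xs \<longleftrightarrow> xs \<noteq> [] \<and> \<not> has_3412_3421 xs"

lemma av_map: "strict_mono_on (set xs) g \<Longrightarrow> av (map g xs) \<longleftrightarrow> av xs"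
  by (simp add: av_def has_3412_3421_map)

text \<open>A final maximum could only be the fourth letter of an occurrence, and that letter must
  be smaller than the first.\<close>

lemma has_3412_3421_max_last:
  assumes "\<And>x. x \<in> set as \<Longrightarrow> x < m"
  shows "has_3412_3421 (as @ [m]) \<longleftrightarrow> has_3412_3421 as"
proof
  assume "has_3412_3421 (as @ [m])"
  then obtain p q r s where sub: "subseq [p, q, r, s] (as @ [m])"
    and less: "p < q" "r < p" "s < p"
    by (rule has_3412_3421E)
  from sub show "has_3412_3421 as"
  proof (cases rule: subseq4_append_cases)
    case 1
    then show ?thesis using less by (rule has_3412_3421I)
  next
    case 2
    then have "p \<in> set as" using subseq_set by fastforce
    then show ?thesis using assms[of p] 2 less by auto
  qed (auto split: if_splits)
next
  assume "has_3412_3421 as"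
  then show "has_3412_3421 (as @ [m])"
    by (rule has_3412_3421_mono) (simp add: subseq_rev_drop_many)
qed

lemma not_has_3412_3421_Nil: "\<not> has_3412_3421 []"
  unfolding has_3412_3421_def occurs_def by simp

lemma bij_betw_av_max_last:
  "bij_betw (\<lambda>as. as @ [N]) (arrangements (\<lambda>xs. \<not> has_3412_3421 xs) {..<N})
     {xs \<in> arrangements av {..<Suc N}. last xs = N}"
proof (rule bij_betwI')
  fix as assume "as \<in> arrangements (\<lambda>xs. \<not> has_3412_3421 xs) {..<N}"
  then have "distinct as" "set as = {..<N}" "\<not> has_3412_3421 as"
    by (simp_all add: arrangements_def)
  then show "as @ [N] \<in> {xs \<in> arrangements av {..<Suc N}. last xs = N}"
    using has_3412_3421_max_last[of as N] by (simp add: arrangements_def av_def lessThan_Suc)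
next
  fix xs assume "xs \<in> {xs \<in> arrangements av {..<Suc N}. last xs = N}"
  then have xs: "distinct xs" "set xs = {..<Suc N}" "av xs" "last xs = N"
    by (auto simp: arrangements_def)
  define as where "as = butlast xs"
  have eq: "xs = as @ [N]"
    using xs(3,4) unfolding as_def av_def by (metis append_butlast_last_id)
  have "distinct as" "N \<notin> set as" "insert N (set as) = {..<Suc N}"
    using xs(1,2) unfolding eq by auto
  then have "set as = {..<N}"
    unfolding lessThan_Suc by (simp add: insert_ident)
  moreover from this have "\<not> has_3412_3421 as"
    using xs(3) has_3412_3421_max_last[of as N] unfolding av_def eq by simp
  ultimately show "\<exists>as\<in>arrangements (\<lambda>xs. \<not> has_3412_3421 xs) {..<N}. xs = as @ [N]"
    using eq \<open>distinct as\<close> by (auto simp: arrangements_def)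
qed simp

text \<open>Here \<sigma> is A b, \<tau> is B and \<open>k\<close> is the length of A b. Since b is
  least in B and A lies below the rest of B, the letters of A b are the \<open>k\<close> smallest
  ones, and B consists of b and the interval from \<open>k\<close> on. The map drops the last letter
  of \<sigma>, but this letter is recovered as the minimum of \<tau>.\<close>

lemma bij_betw_av_max_inner:
  "bij_betw (\<lambda>(k, \<sigma>, \<tau>). butlast \<sigma> @ N # \<tau>)
     (SIGMA k:{1..<Suc N}. SIGMA \<sigma>:arrangements av {..<k}. arrangements av (insert (last \<sigma>) {k..<N}))
     {xs \<in> arrangements av {..<Suc N}. last xs \<noteq> N}" (is "bij_betw ?f ?D ?E")
proof -
  have D: "k \<in> {1..N}" "\<sigma> = butlast \<sigma> @ [last \<sigma>]" "k = length \<sigma>" "last \<sigma> < k"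
      "set (butlast \<sigma>) = {..<k} - {last \<sigma>}" "distinct (butlast \<sigma>)" "\<not> has_3412_3421 \<sigma>"
      "\<tau> \<noteq> []" "distinct \<tau>" "set \<tau> = insert (last \<sigma>) {k..<N}" "last \<sigma> = Min (set \<tau>)"
      "\<not> has_3412_3421 \<tau>"
    if "(k, \<sigma>, \<tau>) \<in> ?D" for k \<sigma> \<tau>
  proof -
    have \<sigma>: "distinct \<sigma>" "set \<sigma> = {..<k}" "\<sigma> \<noteq> []"
      using that by (auto simp: arrangements_def av_def)
    show eq: "\<sigma> = butlast \<sigma> @ [last \<sigma>]"
      using \<sigma>(3) by simp
    show less: "last \<sigma> < k"
      using \<sigma>(2,3) last_in_set by blast
    have "distinct (butlast \<sigma> @ [last \<sigma>])" "set (butlast \<sigma> @ [last \<sigma>]) = {..<k}"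
      unfolding eq[symmetric] using \<sigma> by simp_all
    then have "last \<sigma> \<notin> set (butlast \<sigma>)" "insert (last \<sigma>) (set (butlast \<sigma>)) = {..<k}"
      by simp_all
    then show "set (butlast \<sigma>) = {..<k} - {last \<sigma>}"
      by blast
    show "distinct (butlast \<sigma>)"
      using \<sigma>(1) by (rule distinct_butlast)
    show "k = length \<sigma>"
      using distinct_card[OF \<sigma>(1)] \<sigma>(2) by simp
    show "k \<in> {1..N}" "\<not> has_3412_3421 \<sigma>" "\<tau> \<noteq> []" "distinct \<tau>" "\<not> has_3412_3421 \<tau>"
      using that by (auto simp: arrangements_def av_def)
    show \<tau>: "set \<tau> = insert (last \<sigma>) {k..<N}"
      using that by (simp add: arrangements_def)
    show "last \<sigma> = Min (set \<tau>)"
      unfolding \<tau> using less by (intro Min_eqI[symmetric]) auto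
  qed
  show ?thesis
    unfolding bij_betw_def
  proof (intro conjI inj_onI set_eqI iffI)
    fix u v assume uv: "u \<in> ?D" "v \<in> ?D" "?f u = ?f v"
    obtain k \<sigma> \<tau> where u: "u = (k, \<sigma>, \<tau>)" by (cases u)
    obtain k' \<sigma>' \<tau>' where v: "v = (k', \<sigma>', \<tau>')" by (cases v)
    note Du = D[OF uv(1)[unfolded u]] and Dv = D[OF uv(2)[unfolded v]]
    have "N \<notin> set (butlast \<sigma>)" "N \<notin> set \<tau>"
      using Du(1,4,5,10) by auto
    moreover have "butlast \<sigma> @ N # \<tau> = butlast \<sigma>' @ N # \<tau>'"
      using uv(3) by (simp add: u v)
    ultimately have eq: "butlast \<sigma> = butlast \<sigma>'" "\<tau> = \<tau>'"
      by (simp_all add: append_Cons_eq_iff)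
    then have "\<sigma> = \<sigma>'"
      using Du(2,11) Dv(2,11) by metis
    then show "u = v"
      using Du(3) Dv(3) eq(2) unfolding u v by simp
  next
    fix xs assume "xs \<in> ?f ` ?D"
    then obtain v where v: "v \<in> ?D" "xs = ?f v"
      by blast
    obtain k \<sigma> \<tau> where "v = (k, \<sigma>, \<tau>)" by (cases v)
    with v have u: "(k, \<sigma>, \<tau>) \<in> ?D" and xs: "xs = butlast \<sigma> @ N # \<tau>"
      by simp_all
    note * = D[OF u]
    have dist: "distinct (butlast \<sigma> @ N # \<tau>)"
      using *(1,4,5,6,9,10) by auto
    have "\<not> has_3412_3421 (butlast \<sigma> @ N # \<tau>)"
    proof (subst not_has_3412_3421_split_iff[OF dist, of "last \<sigma>"])
      show "\<not> has_3412_3421 (butlast \<sigma> @ [last \<sigma>]) \<and> \<not> has_3412_3421 \<tau> \<and>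
          (\<forall>a\<in>set (butlast \<sigma>). \<forall>c\<in>set \<tau> - {last \<sigma>}. a < c)"
        unfolding *(2)[symmetric] using *(4,5,7,10,12) by auto
    qed (use *(1,4,5,10) in auto)
    moreover have "set (butlast \<sigma> @ N # \<tau>) = {..<Suc N}"
      using *(1,4,5,10) by auto
    moreover have "last (butlast \<sigma> @ N # \<tau>) \<noteq> N"
      using *(1,4,8,10) last_in_set[OF *(8)] by auto
    ultimately show "xs \<in> ?E"
      using dist unfolding xs arrangements_def av_def by simp
  next
    fix xs assume "xs \<in> ?E"
    then have xs: "distinct xs" "set xs = {..<Suc N}" "\<not> has_3412_3421 xs" "last xs \<noteq> N"
      by (auto simp: arrangements_def av_def)
    have "N \<in> set xs"
      using xs(2) by simp
    then obtain as bs where eq: "xs = as @ N # bs"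
      by (meson split_list)
    have ne: "bs \<noteq> []"
      using xs(4) eq by auto
    have un: "set as \<union> set bs = {..<N}"
    proof -
      have "N \<notin> set as \<union> set bs" "insert N (set as \<union> set bs) = {..<Suc N}"
        using xs(1,2) unfolding eq by auto
      then show ?thesis unfolding lessThan_Suc by (simp add: insert_ident)
    qed
    define b k where "b = Min (set bs)" and "k = card (insert b (set as))"
    have b: "b \<in> set bs" "\<And>x. x \<in> set bs \<Longrightarrow> b \<le> x"
      using ne by (auto simp: b_def)
    have split: "\<not> has_3412_3421 (as @ [b]) \<and> \<not> has_3412_3421 bs \<and> (\<forall>a\<in>set as. \<forall>c\<in>set bs - {b}. a < c)"
      using xs(3) un b xs(1) unfolding eq by (subst (asm) not_has_3412_3421_split_iff[of _ _ _ b]) auto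
    have part: "insert b (set as) \<union> (set bs - {b}) = {..<N}"
      using un b by auto
    have less: "\<forall>i\<in>insert b (set as). \<forall>j\<in>set bs - {b}. i < j"
      using split b(2) by (auto simp: le_less)
    note I = lower_set_partition[OF part less, folded k_def]
    have "b < N" "b < k"
      using un b I by auto
    have "k \<le> N"
    proof -
      have "insert b (set as) \<subseteq> {..<N}"
        using part by blast
      then have "{..<k} \<subseteq> {..<N}"
        by (rule ord_eq_le_trans[OF I(1)[symmetric]])
      then show ?thesis by simp
    qed
    have "set bs = insert b {k..<N}"
      using I(2) b(1) by blast
    moreover have "distinct (as @ [b])" "distinct bs"
      using xs(1) b(1) unfolding eq by auto
    ultimately have "as @ [b] \<in> arrangements av {..<k}" "bs \<in> arrangements av (insert b {k..<N})"
      using I(1) split ne by (simp_all add: arrangements_def av_def)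
    then have "(k, as @ [b], bs) \<in> ?D"
      using \<open>b < k\<close> \<open>k \<le> N\<close> by simp
    then show "xs \<in> ?f ` ?D"
      by (rule rev_image_eqI) (simp add: eq)
  qed
qed

section \<open>Recurrences for the weight sums of words avoiding 3412 and 3421\<close>

lemma sum_av_arrangements:
  fixes g :: "nat list \<Rightarrow> 'b::comm_monoid_add"
  shows "sum g (arrangements av {..<Suc N}) =
    (if N = 0 then g [0] else 0) + (\<Sum>as\<in>arrangements av {..<N}. g (as @ [N])) +
    (\<Sum>k=1..<Suc N. \<Sum>\<sigma>\<in>arrangements av {..<k}.
       \<Sum>\<tau>\<in>arrangements av (insert (last \<sigma>) {k..<N}). g (butlast \<sigma> @ N # \<tau>))"
proof -
  let ?U = "arrangements av {..<Suc N}"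
  have "sum g ?U = sum g {xs \<in> ?U. last xs = N} + sum g {xs \<in> ?U. last xs \<noteq> N}"
    by (subst sum.union_disjoint[symmetric]) (auto intro!: sum.cong)
  also have "sum g {xs \<in> ?U. last xs \<noteq> N} =
    (\<Sum>k=1..<Suc N. \<Sum>\<sigma>\<in>arrangements av {..<k}.
       \<Sum>\<tau>\<in>arrangements av (insert (last \<sigma>) {k..<N}). g (butlast \<sigma> @ N # \<tau>))"
    by (subst sum.reindex_bij_betw[OF bij_betw_av_max_inner, symmetric])
      (simp add: sum.Sigma case_prod_unfold del: sum.op_ivl_Suc)
  also have "sum g {xs \<in> ?U. last xs = N} =
      (\<Sum>as\<in>arrangements (\<lambda>xs. \<not> has_3412_3421 xs) {..<N}. g (as @ [N]))"
    by (rule sum.reindex_bij_betw[OF bij_betw_av_max_last, symmetric])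
  also have "\<dots> = (if N = 0 then g [0] else 0) + (\<Sum>as\<in>arrangements av {..<N}. g (as @ [N]))"
  \<comment> \<open>Only for \<open>N = 0\<close> can the word before the maximum be empty. As
    \<open>av\<close> demands nonempty words, this case yields the separate term
    \<open>g [0]\<close>.\<close>
  proof (cases "N = 0")
    case True
    have "arrangements (\<lambda>xs. \<not> has_3412_3421 xs) ({} :: nat set) = {[]}" "arrangements av {} = {}"
      by (auto simp: arrangements_def av_def not_has_3412_3421_Nil)
    with True show ?thesis by simp
  next
    case False
    have "xs \<noteq> []" if "set xs = {..<N}" for xs
      using False that by (metis lessThan_empty_iff list.set(1))
    then have "arrangements (\<lambda>xs. \<not> has_3412_3421 xs) {..<N} = arrangements av {..<N}"
      unfolding arrangements_def av_def by (intro Collect_cong) blast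
    with False show ?thesis by simp
  qed
  finally show ?thesis .
qed

text \<open>For \<sigma> = A b this is what A and the maximum contribute in A N B, apart from the
  \<open>X\<close> for the descent after N. If A is empty, N stands between infinity and a smaller
  letter and is a double descent, whence the value \<open>Y\<close>. Otherwise N follows a smaller
  letter and is none, and the last letter of A is followed by a larger one, whence the right flag
  \<open>False\<close>.\<close>

definition init_weight :: "nat list \<Rightarrow> int poly poly" where
  "init_weight \<sigma> = (if butlast \<sigma> = [] then Y else weight True (butlast \<sigma>) False)"

definition av_sum :: "nat \<Rightarrow> int poly poly" where
  "av_sum n = (\<Sum>xs\<in>arrangements av {..<n}. weight True xs False)"

definition av_init_sum :: "nat \<Rightarrow> int poly poly" where
  "av_init_sum n = (\<Sum>xs\<in>arrangements av {..<n}. init_weight xs)"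

lemma init_weight_map: "strict_mono_on (set xs) g \<Longrightarrow> init_weight (map g xs) = init_weight xs"
proof -
  assume "strict_mono_on (set xs) g"
  moreover have "set (butlast xs) \<subseteq> set xs"
    by (auto dest: in_set_butlastD)
  ultimately have "strict_mono_on (set (butlast xs)) g"
    by (rule monotone_on_subset)
  then show ?thesis
    by (simp add: init_weight_def map_butlast[symmetric] weight_map)
qed

lemma weight_append_max_last:
  assumes "\<And>x. x \<in> set as \<Longrightarrow> x < N"
  shows "weight True (as @ [N]) r =
    (if as = [] then if r then Y else 1 else weight True as False)"
proof (cases "as = []")
  case False
  then have "\<not> N < last as"
    using assms[of "last as"] by simp
  with False show ?thesis
    by (simp add: weight_append Let_def)
qed simp

lemma weight_append_max_inner:
  assumes "\<And>x. x \<in> set as \<union> set bs \<Longrightarrow> x < N" "bs \<noteq> []"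
  shows "weight True (as @ N # bs) False =
    (if as = [] then Y else weight True as False) * X * weight True bs False"
proof -
  have "hd bs < N"
    using assms by simp
  then have "weight True ((as @ [N]) @ bs) False = weight True (as @ [N]) True * X * weight True bs False"
    using assms(2) by (subst weight_append) (simp_all add: Let_def)
  then show ?thesis
    using weight_append_max_last[of as N True] assms(1) by simp
qed

lemma sum_av_insert_interval:
  assumes "b < k" "k \<le> N" "\<And>g xs. strict_mono_on (set xs) g \<Longrightarrow> f (map g xs) = f xs"
  shows "sum f (arrangements av (insert b {k..<N})) = sum f (arrangements av {..<Suc N - k})"
proof -
  have "card (insert b {k..<N}) = Suc N - k"
    using assms by simp
  then show ?thesis
    using sum_arrangements_card[of "insert b {k..<N}" av f] av_map assms(3) by simp
qed

lemma inner_pairD: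
  assumes "\<sigma> \<in> arrangements av {..<k}" "\<tau> \<in> arrangements av (insert (last \<sigma>) {k..<N})" "k \<le> N"
  shows "\<sigma> \<noteq> []" "last \<sigma> < k" "\<tau> \<noteq> []" "\<And>x. x \<in> set (butlast \<sigma>) \<union> set \<tau> \<Longrightarrow> x < N"
    "length \<sigma> = k" "length \<tau> = Suc N - k"
proof -
  show *: "\<sigma> \<noteq> []" "\<tau> \<noteq> []"
    using assms by (auto simp: arrangements_def av_def)
  have set: "set \<sigma> = {..<k}" "set \<tau> = insert (last \<sigma>) {k..<N}"
    using assms by (simp_all add: arrangements_def)
  show less: "last \<sigma> < k"
    using last_in_set[OF *(1)] set(1) by simp
  show "x < N" if "x \<in> set (butlast \<sigma>) \<union> set \<tau>" for x
    using that less assms(3) in_set_butlastD[of x \<sigma>] unfolding set by auto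
  show "length \<sigma> = k" "length \<tau> = Suc N - k"
    using length_arrangements[OF assms(1)] length_arrangements[OF assms(2)] less assms(3) by simp_all
qed

lemma arrangements_av_empty [simp]: "arrangements av {} = {}"
  by (auto simp: arrangements_def av_def)

lemma arrangements_av_singleton: "arrangements av {b} = {[b]}"
proof (intro set_eqI iffI)
  fix xs assume "xs \<in> arrangements av {b}"
  then have xs: "distinct xs" "set xs = {b}"
    by (simp_all add: arrangements_def)
  then have "length xs = 1"
    using distinct_card[OF xs(1)] by simp
  then obtain a where "xs = [a]"
    by (cases xs) simp_all
  with xs(2) show "xs \<in> {[b]}" by simp
next
  fix xs assume "xs \<in> {[b]}"
  then show "xs \<in> arrangements av {b}"
    by (simp add: arrangements_def av_def has_3412_3421_def occurs_def)
qed

lemma av_append_max_weights: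
  fixes as :: "nat list"
  assumes "as \<in> arrangements av {..<N}"
  shows "weight True (as @ [N]) False = weight True as False" "init_weight (as @ [N]) = weight True as False"
proof -
  have "as \<noteq> []" "\<And>x. x \<in> set as \<Longrightarrow> x < N"
    using assms by (auto simp: arrangements_def av_def)
  then show "weight True (as @ [N]) False = weight True as False" "init_weight (as @ [N]) = weight True as False"
    using weight_append_max_last[of as N False] by (simp_all add: init_weight_def)
qed

text \<open>A final maximum leaves the weight of the prefix unchanged. Otherwise A b has length
  \<open>k\<close> and B has length \<open>Suc N - k\<close>; the lengths add up to that of A N B
  because b, counted twice, makes up for N.\<close>

lemma av_sum_Suc:
  "av_sum (Suc N) = (if N = 0 then 1 else 0) + av_sum N +
     (\<Sum>k=1..<Suc N. X * av_init_sum k * av_sum (Suc N - k))"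
proof -
  have inner: "(\<Sum>\<sigma>\<in>arrangements av {..<k}. \<Sum>\<tau>\<in>arrangements av (insert (last \<sigma>) {k..<N}).
       weight True (butlast \<sigma> @ N # \<tau>) False) = X * av_init_sum k * av_sum (Suc N - k)"
    if "k \<in> {1..<Suc N}" for k
  proof -
    have "k \<le> N" using that by simp
    have "(\<Sum>\<tau>\<in>arrangements av (insert (last \<sigma>) {k..<N}). weight True (butlast \<sigma> @ N # \<tau>) False)
        = X * init_weight \<sigma> * av_sum (Suc N - k)" if \<sigma>: "\<sigma> \<in> arrangements av {..<k}" for \<sigma>
    proof -
      have "weight True (butlast \<sigma> @ N # \<tau>) False = X * init_weight \<sigma> * weight True \<tau> False"
        if "\<tau> \<in> arrangements av (insert (last \<sigma>) {k..<N})" for \<tau>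
        using weight_append_max_inner[OF inner_pairD(4,3)[OF \<sigma> that \<open>k \<le> N\<close>]]
        by (simp add: init_weight_def)
      moreover have "last \<sigma> < k"
        using \<sigma> last_in_set[of \<sigma>] by (auto simp: arrangements_def av_def)
      ultimately show ?thesis
        unfolding av_sum_def using \<open>k \<le> N\<close>
        by (subst sum_av_insert_interval[of "last \<sigma>" k N, symmetric])
          (simp_all add: weight_map sum_distrib_left)
    qed
    then show ?thesis
      by (simp add: av_init_sum_def sum_distrib_left sum_distrib_right)
  qed
  have last: "(\<Sum>as\<in>arrangements av {..<N}. weight True (as @ [N]) False) = av_sum N"
    unfolding av_sum_def by (intro sum.cong refl av_append_max_weights)
  show ?thesis
    unfolding av_sum_def[of "Suc N"] sum_av_arrangements last
    by (intro arg_cong2[where f = "(+)"] sum.cong refl inner) simp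
qed

text \<open>Removing the last letter of A N B removes it from B, so B again contributes an
  \<open>init_weight\<close>, unless B is the single letter b. In that case, \<open>k = N\<close>,
  the letter N becomes final: there is no descent after it, so the factor \<open>X\<close>
  disappears, and for empty A the letter N is no double descent, so \<open>Y\<close> has to be
  replaced by 1. Hence \<open>Y\<close>, the value for length one, is subtracted inside the
  convolution, and the last summand supplies the corrected term.\<close>

lemma av_init_sum_Suc:
  "av_init_sum (Suc N) = (if N = 0 then Y else 0) + av_sum N +
     (\<Sum>k=1..<Suc N. X * av_init_sum k * (av_init_sum (Suc N - k) - (if Suc N - k = 1 then Y else 0))) +
     (av_init_sum N + (if N = 1 then 1 - Y else 0))"
proof -
  have inner: "(\<Sum>\<sigma>\<in>arrangements av {..<k}. \<Sum>\<tau>\<in>arrangements av (insert (last \<sigma>) {k..<N}).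
       init_weight (butlast \<sigma> @ N # \<tau>)) = X * av_init_sum k * (av_init_sum (Suc N - k) - (if Suc N - k = 1 then Y else 0))
       + (if k = N then av_init_sum N + (if N = 1 then 1 - Y else 0) else 0)"
    if "k \<in> {1..<Suc N}" for k
  proof -
    have "k \<le> N" using that by simp
    have last: "last \<sigma> < k" if "\<sigma> \<in> arrangements av {..<k}" for \<sigma>
      using that last_in_set[of \<sigma>] by (auto simp: arrangements_def av_def)
    show ?thesis
    proof (cases "k = N")
      case True
      have "init_weight (butlast \<sigma> @ [N, last \<sigma>]) =
          init_weight \<sigma> + (if N = 1 then 1 - Y else 0)" if \<sigma>: "\<sigma> \<in> arrangements av {..<N}" for \<sigma>
      proof -
        have b: "butlast (butlast \<sigma> @ [N, last \<sigma>]) = butlast \<sigma> @ [N]"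
          by (simp add: butlast_append)
        have less: "x < N" if "x \<in> set (butlast \<sigma>)" for x
        proof -
          have "x \<in> set \<sigma>" using that by (rule in_set_butlastD)
          moreover have "set \<sigma> = {..<N}" using \<sigma> by (simp add: arrangements_def)
          ultimately show ?thesis by simp
        qed
        have "length \<sigma> = N" "\<sigma> \<noteq> []"
          using length_arrangements[OF \<sigma>] \<sigma> by (simp_all add: arrangements_def av_def)
        then have "butlast \<sigma> = [] \<longleftrightarrow> N = 1"
          by (cases \<sigma>) auto
        then show ?thesis
          unfolding init_weight_def[of "butlast \<sigma> @ [N, last \<sigma>]"] b
          using weight_append_max_last[OF less] by (simp add: init_weight_def)
      qed
      then have "(\<Sum>\<sigma>\<in>arrangements av {..<N}. \<Sum>\<tau>\<in>arrangements av (insert (last \<sigma>) {k..<N}).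
         init_weight (butlast \<sigma> @ N # \<tau>)) = (\<Sum>\<sigma>\<in>arrangements av {..<N}. init_weight \<sigma> + (if N = 1 then 1 - Y else 0))"
        using True by (intro sum.cong refl) (simp add: arrangements_av_singleton)
      \<comment> \<open>The correction is added once per \<sigma>, but it is nonzero only for
        \<open>N = 1\<close>, when there is a single \<sigma>.\<close>
      also have "\<dots> = av_init_sum N + (if N = 1 then 1 - Y else 0)"
        using arrangements_av_singleton[of 0] by (auto simp: av_init_sum_def sum.distrib lessThan_Suc)
      moreover have "av_init_sum (Suc 0) = Y"
        using arrangements_av_singleton[of 0] by (simp add: av_init_sum_def lessThan_Suc init_weight_def)
      ultimately show ?thesis
        using True by simp
    next
      case False
      then have "k < N" using \<open>k \<le> N\<close> by simp
      have "(\<Sum>\<tau>\<in>arrangements av (insert (last \<sigma>) {k..<N}). init_weight (butlast \<sigma> @ N # \<tau>))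
        = X * init_weight \<sigma> * av_init_sum (Suc N - k)" if \<sigma>: "\<sigma> \<in> arrangements av {..<k}" for \<sigma>
      proof -
        have "init_weight (butlast \<sigma> @ N # \<tau>) = X * init_weight \<sigma> * init_weight \<tau>"
          if \<tau>: "\<tau> \<in> arrangements av (insert (last \<sigma>) {k..<N})" for \<tau>
        proof -
          note * = inner_pairD[OF \<sigma> \<tau> \<open>k \<le> N\<close>]
          have b: "butlast (butlast \<sigma> @ N # \<tau>) = butlast \<sigma> @ N # butlast \<tau>"
            using *(3) by (simp add: butlast_append)
          \<comment> \<open>Here \<tau> has at least two letters, so N keeps its smaller
            successor.\<close>
          have ne: "butlast \<tau> \<noteq> []"
            using *(6) \<open>k < N\<close> by (simp flip: length_0_conv)
          have "x < N" if "x \<in> set (butlast \<sigma>) \<union> set (butlast \<tau>)" for x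
            using that *(4) in_set_butlastD[of x \<tau>] by blast
          from weight_append_max_inner[OF this ne] show ?thesis
            unfolding init_weight_def b using ne by simp
        qed
        then show ?thesis
          unfolding av_init_sum_def using \<open>k \<le> N\<close> last[OF \<sigma>]
          by (subst sum_av_insert_interval[of "last \<sigma>" k N, symmetric])
            (simp_all add: init_weight_map sum_distrib_left)
      qed
      then show ?thesis
        using \<open>k < N\<close> by (simp add: av_init_sum_def sum_distrib_left sum_distrib_right)
    qed
  qed
  have last: "(\<Sum>as\<in>arrangements av {..<N}. init_weight (as @ [N])) = av_sum N"
    unfolding av_sum_def by (intro sum.cong refl av_append_max_weights)
  have "av_init_sum (Suc N) = (if N = 0 then Y else 0) + av_sum N +
     (\<Sum>k=1..<Suc N. X * av_init_sum k * (av_init_sum (Suc N - k) - (if Suc N - k = 1 then Y else 0))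
       + (if k = N then av_init_sum N + (if N = 1 then 1 - Y else 0) else 0))"
    unfolding av_init_sum_def[of "Suc N"] sum_av_arrangements last
    by (intro arg_cong2[where f = "(+)"] sum.cong refl inner) (simp add: init_weight_def)
  moreover have "(\<Sum>k=1..<Suc N. if k = N then av_init_sum N + (if N = 1 then 1 - Y else 0) else 0)
      = av_init_sum N + (if N = 1 then 1 - Y else 0)"
    by (cases "N = 0") (simp_all add: sum.delta av_init_sum_def del: sum.op_ivl_Suc)
  ultimately show ?thesis
    by (simp only: sum.distrib add.assoc)
qed

section \<open>The power series of words avoiding 3412 and 3421, and elimination of the auxiliary
  series\<close>

unbundle fps_syntax

lemma fps_mult_nth_Suc_interior:
  fixes f g :: "'a::comm_ring_1 fps"
  assumes "f $ 0 = 0" "g $ 0 = 0"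
  shows "(f * g) $ n = (\<Sum>k=1..<n. f $ k * g $ (n - k))"
proof -
  have "(\<Sum>k=0..n. f $ k * g $ (n - k)) = (\<Sum>k=1..<n. f $ k * g $ (n - k))"
    using assms by (intro sum.mono_neutral_right) (auto simp: not_less Suc_le_eq)
  then show ?thesis
    by (simp add: fps_mult_nth)
qed

lemma av_fps_system:
  fixes S T z x y :: "int poly poly fps"
  defines "S \<equiv> Abs_fps av_sum" and "T \<equiv> Abs_fps av_init_sum" and "z \<equiv> fps_X"
    and "x \<equiv> fps_const X" and "y \<equiv> fps_const Y"
  shows "S = z + z * S + x * T * S"
    and "T = y * z + z * S + x * T * (T - y * z) + z * (T + (1 - y) * z)"
proof -
  have zero: "av_sum 0 = 0" "av_init_sum 0 = 0"
    by (simp_all add: av_sum_def av_init_sum_def)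
  have nth: "S $ n = av_sum n" "T $ n = av_init_sum n" for n
    by (simp_all add: S_def T_def)
  show "S = z + z * S + x * T * S"
  proof (rule fps_ext)
    fix n
    show "S $ n = (z + z * S + x * T * S) $ n"
    proof (cases n)
      case 0
      then show ?thesis by (simp add: z_def nth zero)
    next
      case (Suc N)
      have "(x * T * S) $ Suc N = (\<Sum>k=1..<Suc N. X * av_init_sum k * av_sum (Suc N - k))"
        by (subst fps_mult_nth_Suc_interior) (simp_all add: zero x_def nth del: sum.op_ivl_Suc)
      moreover have "(z * S) $ Suc N = av_sum N" "z $ Suc N = (if N = 0 then 1 else 0)"
        by (simp_all add: z_def nth)
      ultimately show ?thesis
        unfolding Suc nth fps_add_nth av_sum_Suc by (simp only:)
    qed
  qed
  show "T = y * z + z * S + x * T * (T - y * z) + z * (T + (1 - y) * z)"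
  proof (rule fps_ext)
    fix n
    show "T $ n = (y * z + z * S + x * T * (T - y * z) + z * (T + (1 - y) * z)) $ n"
    proof (cases n)
      case 0
      then show ?thesis by (simp add: z_def nth zero)
    next
      case (Suc N)
      have yz: "(y * z) $ m = (if m = 1 then Y else 0)" for m
        by (simp add: y_def z_def fps_X_def)
      have const: "1 - y = fps_const (1 - Y)"
        by (simp add: y_def flip: fps_const_sub)
      have y'z: "((1 - y) * z) $ m = (if m = 1 then 1 - Y else 0)" for m
        unfolding const by (simp add: z_def fps_X_def)
      have init: "(x * T) $ 0 = 0" "(T - y * z) $ 0 = 0"
        by (simp_all add: z_def nth zero)
      have "(x * T * (T - y * z)) $ Suc N = (\<Sum>k=1..<Suc N. X * av_init_sum k *
          (av_init_sum (Suc N - k) - (if Suc N - k = 1 then Y else 0)))"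
        unfolding fps_mult_nth_Suc_interior[OF init] fps_sub_nth yz nth
        by (simp add: x_def nth del: sum.op_ivl_Suc)
      moreover have "(z * (T + (1 - y) * z)) $ Suc N = (T + (1 - y) * z) $ N"
        unfolding z_def by (rule fps_X_mult_nth[THEN trans]) simp
      then have "(z * (T + (1 - y) * z)) $ Suc N = av_init_sum N + (if N = 1 then 1 - Y else 0)"
        unfolding fps_add_nth y'z nth .
      moreover have "(z * S) $ Suc N = av_sum N"
        by (simp add: z_def nth)
      ultimately show ?thesis
        unfolding Suc nth fps_add_nth av_init_sum_Suc yz by simp
    qed
  qed
qed

text \<open>The first equation of the system gives x T S = S - z - z S. Multiplying the second one
  by x S^2 and substituting this removes T. What remains is z times the cubic, which explains the
  factor that is cancelled at the end.\<close>

lemma av_fps_cubic: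
  fixes S z x y :: "int poly poly fps"
  defines "S \<equiv> Abs_fps av_sum" and "z \<equiv> fps_X" and "x \<equiv> fps_const X" and "y \<equiv> fps_const Y"
  shows "S = z + (1 + x * y) * z * S + x * z * S ^ 2 + x * S ^ 3"
proof -
  define T where "T = Abs_fps av_init_sum"
  have S: "S = z + z * S + x * T * S"
    and T: "T = y * z + z * S + x * T * (T - y * z) + z * (T + (1 - y) * z)"
    unfolding S_def T_def z_def x_def y_def by (rule av_fps_system)+
  have "z * (S - (z + (1 + x * y) * z * S + x * z * S ^ 2 + x * S ^ 3)) = 0"
    using S T by algebra
  moreover have "z \<noteq> 0"
    by (simp add: z_def)
  ultimately show ?thesis
    by simp
qed
section \<open>Separable words\<close>

lemma has_2413_3142_cases:
  assumes "has_2413_3142 xs"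
  obtains a b c d where "subseq [a, b, c, d] xs" "c < a" "a < d" "d < b"
    | a b c d where "subseq [a, b, c, d] xs" "b < d" "d < a" "a < c"
  using assms unfolding has_2413_3142_def by (elim occursE disjE conjE)

lemma has_2413_3142I1:
  "subseq [a, b, c, d] xs \<Longrightarrow> c < a \<Longrightarrow> a < d \<Longrightarrow> d < b \<Longrightarrow> has_2413_3142 xs"
  unfolding has_2413_3142_def by (intro occursI disjI1 conjI)

lemma has_2413_3142I2:
  "subseq [a, b, c, d] xs \<Longrightarrow> b < d \<Longrightarrow> d < a \<Longrightarrow> a < c \<Longrightarrow> has_2413_3142 xs"
  unfolding has_2413_3142_def by (intro occursI disjI2 conjI)

lemma has_2413_3142_mono: "has_2413_3142 xs \<Longrightarrow> subseq xs ys \<Longrightarrow> has_2413_3142 ys"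
  unfolding has_2413_3142_def by (rule occurs_mono)

definition blocks :: "('a \<Rightarrow> 'a \<Rightarrow> bool) \<Rightarrow> 'a list \<Rightarrow> 'a list \<Rightarrow> bool" where
  "blocks r \<alpha> \<beta> \<longleftrightarrow> \<alpha> \<noteq> [] \<and> \<beta> \<noteq> [] \<and> (\<forall>a\<in>set \<alpha>. \<forall>b\<in>set \<beta>. r a b)"

text \<open>For \<open>r = (<)\<close> this is decomposability as a direct sum, for \<open>r = (>)\<close> as a skew sum.\<close>

definition decomposable :: "('a \<Rightarrow> 'a \<Rightarrow> bool) \<Rightarrow> 'a list \<Rightarrow> bool" where
  "decomposable r xs \<longleftrightarrow> (\<exists>\<alpha> \<beta>. blocks r \<alpha> \<beta> \<and> xs = \<alpha> @ \<beta>)"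

lemma decomposableI: "blocks r \<alpha> \<beta> \<Longrightarrow> decomposable r (\<alpha> @ \<beta>)"
  by (auto simp: decomposable_def)

text \<open>Wherever 2413 or 3142 is cut into two nonempty parts, some letter of the first part is
  smaller and some is larger than a letter of the second. Across blocks all comparisons go the same
  way, so an occurrence cannot be cut.\<close>

lemma has_2413_3142_append:
  fixes \<alpha> :: "'a::linorder list"
  assumes r: "r = (<) \<or> r = (>)" and bl: "blocks r \<alpha> \<beta>"
  shows "has_2413_3142 (\<alpha> @ \<beta>) \<longleftrightarrow> has_2413_3142 \<alpha> \<or> has_2413_3142 \<beta>"
proof
  have cases: "subseq [a, b, c, d] \<alpha> \<or> subseq [a, b, c, d] \<beta>"
    if sub: "subseq [a, b, c, d] (\<alpha> @ \<beta>)" and pat: "c < a \<and> a < d \<and> d < b \<or> b < d \<and> d < a \<and> a < c" for a b c d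
  proof -
    have less: "(u < v \<or> v < u) \<and> (u < v) = (r = (<))" if "u \<in> set \<alpha>" "v \<in> set \<beta>" for u v
    proof -
      have "r u v" using bl that by (simp add: blocks_def)
      \<comment> \<open>On a one-element type \<open>(<)\<close> and \<open>(>)\<close> coincide; a
        pair related by \<open>r\<close> rules this out.\<close>
      moreover have "r \<noteq> (<)" if "r = (>)" "r u v"
        using that by (metis order.asym)
      ultimately show ?thesis using r by (metis order.asym)
    qed
    from sub show ?thesis
    proof (cases rule: subseq4_append_cases)
      case 2
      then have "a \<in> set \<alpha>" "b \<in> set \<alpha>" "c \<in> set \<alpha>" using subseq_set by fastforce+
      then show ?thesis using less[of a d] less[of b d] less[of c d] 2 pat by (metis order.asym order.strict_trans)
    next
      case 3
      then have "a \<in> set \<alpha>" "b \<in> set \<alpha>" "c \<in> set \<beta>" "d \<in> set \<beta>" using subseq_set by fastforce+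
      then show ?thesis using less[of a c] less[of a d] less[of b c] less[of b d] pat by (metis order.asym order.strict_trans)
    next
      case 4
      then have "b \<in> set \<beta>" "c \<in> set \<beta>" "d \<in> set \<beta>" using subseq_set by fastforce+
      then show ?thesis using less[of a b] less[of a c] less[of a d] 4 pat by (metis order.asym order.strict_trans)
    qed auto
  qed
  assume "has_2413_3142 (\<alpha> @ \<beta>)"
  then show "has_2413_3142 \<alpha> \<or> has_2413_3142 \<beta>"
  proof (cases rule: has_2413_3142_cases)
    case (1 a b c d)
    then have "subseq [a, b, c, d] \<alpha> \<or> subseq [a, b, c, d] \<beta>" using cases by blast
    with 1 show ?thesis using has_2413_3142I1 by blast
  next
    case (2 a b c d)
    then have "subseq [a, b, c, d] \<alpha> \<or> subseq [a, b, c, d] \<beta>" using cases by blast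
    with 2 show ?thesis using has_2413_3142I2 by blast
  qed
next
  assume "has_2413_3142 \<alpha> \<or> has_2413_3142 \<beta>"
  moreover have "subseq \<alpha> (\<alpha> @ \<beta>)" "subseq \<beta> (\<alpha> @ \<beta>)"
    by (simp_all add: subseq_rev_drop_many subseq_drop_many)
  ultimately show "has_2413_3142 (\<alpha> @ \<beta>)"
    using has_2413_3142_mono by blast
qed

text \<open>Turns a property closed under moving to earlier letters into a cut of the word; this
  produces the forbidden decomposition in the lemma on appending a letter.\<close>

lemma filter_append_filter_not:
  assumes "\<And>p q. subseq [p, q] xs \<Longrightarrow> P q \<Longrightarrow> P p"
  shows "filter P xs @ filter (\<lambda>x. \<not> P x) xs = xs"
  using assms
proof (induction xs)
  case (Cons a xs)
  have IH: "filter P xs @ filter (\<lambda>x. \<not> P x) xs = xs"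
  proof (rule Cons.IH)
    fix p q assume "subseq [p, q] xs" "P q"
    then show "P p" by (intro Cons.prems[of p q] list_emb_Cons)
  qed
  show ?case
  proof (cases "P a")
    case False
    have "\<not> P q" if "q \<in> set xs" for q
      using Cons.prems[of a q] that False by (auto simp: subseq_singleton_left)
    then have "filter P xs = []" "filter (\<lambda>x. \<not> P x) xs = xs"
      by (auto simp: filter_empty_conv)
    with False show ?thesis by simp
  qed (use IH in simp)
qed simp

text \<open>A shortest left block will do: a cut inside it, with the remainder moved to the right
  block, would give a shorter one.\<close>

lemma decomposable_shortest:
  assumes "decomposable r xs"
  obtains \<alpha> \<beta> where "blocks r \<alpha> \<beta>" "xs = \<alpha> @ \<beta>" "\<not> decomposable r \<alpha>"
proof -
  define Q where "Q k \<longleftrightarrow> (\<exists>\<alpha> \<beta>. blocks r \<alpha> \<beta> \<and> xs = \<alpha> @ \<beta> \<and> length \<alpha> = k)" for k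
  have "\<exists>k. Q k"
    using assms by (auto simp: decomposable_def Q_def)
  then have "Q (LEAST k. Q k)"
    by (rule LeastI_ex)
  then obtain \<alpha> \<beta> where *: "blocks r \<alpha> \<beta>" "xs = \<alpha> @ \<beta>" and len: "length \<alpha> = (LEAST k. Q k)"
    unfolding Q_def by blast
  have "\<not> decomposable r \<alpha>"
  proof
    assume "decomposable r \<alpha>"
    then obtain \<gamma> \<delta> where **: "blocks r \<gamma> \<delta>" "\<alpha> = \<gamma> @ \<delta>"
      by (auto simp: decomposable_def)
    then have "blocks r \<gamma> (\<delta> @ \<beta>)"
      using *(1) by (auto simp: blocks_def)
    then have "Q (length \<gamma>)"
      unfolding Q_def by (intro exI[of _ \<gamma>] exI[of _ "\<delta> @ \<beta>"]) (simp add: *(2) **(2))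
    then have "length \<alpha> \<le> length \<gamma>"
      unfolding len by (rule Least_le)
    then show False
      using ** by (simp add: blocks_def)
  qed
  with * that show thesis by blast
qed

text \<open>Compare \<open>v\<close> with the indecomposable first block. If the whole block is on
  the \<open>r\<close>-smaller side of \<open>v\<close>, then \<open>v\<close> joins the second
  block. If it is on the other side, so is the second block by transitivity, and \<open>v\<close>
  alone becomes the second block of a sum of the opposite kind. If \<open>v\<close> separates the
  letters of the first block, avoidance forces those \<open>r\<close>-below \<open>v\<close> to come
  first, which would decompose that block.\<close>

lemma decomposable_snoc:
  fixes xs :: "'a::linorder list"
  assumes r: "r = (<) \<and> r' = (>) \<or> r = (>) \<and> r' = (<)"
    and dist: "distinct (xs @ [v])" and av: "\<not> has_2413_3142 (xs @ [v])" and dec: "decomposable r xs"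
  shows "decomposable r (xs @ [v]) \<or> decomposable r' (xs @ [v])"
proof -
  have trans: "r a c" if "r a b" "r b c" for a b c
    using r that by auto
  have total: "r a b \<or> r b a" if "a \<noteq> b" for a b
    using r that by auto
  have conv: "r' a b \<longleftrightarrow> r b a" for a b
    using r by auto
  have asym: "\<not> r b a" if "r a b" for a b
    using r that by auto
  obtain \<alpha> \<beta> where bl: "blocks r \<alpha> \<beta>" and xs: "xs = \<alpha> @ \<beta>" and nd: "\<not> decomposable r \<alpha>"
    using dec by (rule decomposable_shortest)
  have ne: "\<alpha> \<noteq> []" "\<beta> \<noteq> []" and cut: "\<And>a b. a \<in> set \<alpha> \<Longrightarrow> b \<in> set \<beta> \<Longrightarrow> r a b"
    using bl by (simp_all add: blocks_def)
  have neq: "a \<noteq> v" if "a \<in> set \<alpha>" for a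
    using dist that xs by auto
  consider (up) "\<And>a. a \<in> set \<alpha> \<Longrightarrow> r a v" | (down) "\<And>a. a \<in> set \<alpha> \<Longrightarrow> r v a"
    | (mixed) a b where "a \<in> set \<alpha>" "r a v" "b \<in> set \<alpha>" "r v b"
    using total neq by metis
  then show ?thesis
  proof cases
    case up
    then have "blocks r \<alpha> (\<beta> @ [v])"
      using ne cut by (auto simp: blocks_def)
    then show ?thesis
      using decomposableI[of r \<alpha> "\<beta> @ [v]"] by (simp add: xs)
  next
    case down
    have "r v b" if "b \<in> set \<beta>" for b
      using trans[OF down cut] that ne(1) hd_in_set by blast
    then have "blocks r' xs [v]"
      using ne(1) down by (auto simp: blocks_def conv xs)
    then show ?thesis
      using decomposableI by blast
  next
    case (mixed a b)
    let ?P = "\<lambda>x. r x v"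
    have "filter ?P \<alpha> @ filter (\<lambda>x. \<not> ?P x) \<alpha> = \<alpha>"
    proof (rule filter_append_filter_not, rule ccontr)
      fix p q assume sub: "subseq [p, q] \<alpha>" and q: "r q v" and p: "\<not> r p v"
      have "p \<in> set \<alpha>"
        using subseq_set[OF sub] by simp
      then have "r v p"
        using total[OF neq] p by blast
      obtain c where c: "c \<in> set \<beta>"
        using ne(2) hd_in_set by blast
      \<comment> \<open>With c from the second block, the letters p, q, c, v form 3142 if
        \<open>r\<close> is \<open>(<)\<close> and 2413 if \<open>r\<close> is
        \<open>(>)\<close>.\<close>
      have "subseq ([p, q] @ [c] @ [v]) (\<alpha> @ \<beta> @ [v])"
        using sub c by (intro list_emb_append_mono) (simp_all add: subseq_singleton_left)
      then have sub': "subseq [p, q, c, v] (xs @ [v])"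
        by (simp add: xs)
      have "r p c"
        using cut c \<open>p \<in> set \<alpha>\<close> by blast
      then have "has_2413_3142 (xs @ [v])"
        using r q \<open>r v p\<close> has_2413_3142I1[OF sub'] has_2413_3142I2[OF sub'] by (elim disjE) simp_all
      with av show False by blast
    qed
    moreover have "blocks r (filter ?P \<alpha>) (filter (\<lambda>x. \<not> ?P x) \<alpha>)"
      unfolding blocks_def
    proof (intro conjI ballI)
      show "filter ?P \<alpha> \<noteq> []" "filter (\<lambda>x. \<not> ?P x) \<alpha> \<noteq> []"
        using mixed asym unfolding filter_empty_conv by blast+
      fix s t assume "s \<in> set (filter ?P \<alpha>)" "t \<in> set (filter (\<lambda>x. \<not> ?P x) \<alpha>)"
      then have "r s v" "r v t"
        using total[OF neq[of t]] by auto
      then show "r s t" by (rule trans)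
    qed
    ultimately have "decomposable r \<alpha>"
      using decomposableI by metis
    with nd show ?thesis by blast
  qed
qed

lemma separable_decomposable:
  fixes xs :: "'a::linorder list"
  assumes "distinct xs" "\<not> has_2413_3142 xs" "length xs \<ge> 2"
  shows "decomposable (<) xs \<or> decomposable (>) xs"
  using assms
proof (induction xs rule: rev_induct)
  case (snoc v xs)
  show ?case
  proof (cases "length xs \<ge> 2")
    case True
    have "\<not> has_2413_3142 xs"
      using snoc.prems(2) has_2413_3142_mono[of xs "xs @ [v]"] by (auto simp: subseq_rev_drop_many)
    then have "decomposable (<) xs \<or> decomposable (>) xs"
      using snoc True by simp
    then show ?thesis
      using decomposable_snoc[of "(<)" "(>)" xs v] decomposable_snoc[of "(>)" "(<)" xs v] snoc.prems
      by blast
  next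
    case False
    then have "length xs = Suc 0" using snoc.prems(3) by simp
    then obtain u where "xs = [u]" by (cases xs) auto
    with snoc.prems(1) have "blocks (<) xs [v] \<or> blocks (>) xs [v]"
      by (auto simp: blocks_def)
    then show ?thesis
      using decomposableI by blast
  qed
qed simp

text \<open>Serves to show that no word is both a direct and a skew sum.\<close>

lemma decomposable_hd_last: "decomposable r xs \<Longrightarrow> r (hd xs) (last xs)"
  by (auto simp: decomposable_def blocks_def)

lemma decomposable_length: "decomposable r xs \<Longrightarrow> length xs \<ge> 2"
  unfolding decomposable_def blocks_def by (auto simp: Suc_le_eq simp flip: length_greater_0_conv)

lemma decomposable_map:
  fixes g :: "'a::linorder \<Rightarrow> 'a"
  assumes "r = (<) \<or> r = (>)" "strict_mono_on (set xs) g"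
  shows "decomposable r (map g xs) \<longleftrightarrow> decomposable r xs"
proof -
  have *: "blocks r (map g \<alpha>) (map g \<beta>) \<longleftrightarrow> blocks r \<alpha> \<beta>" if "xs = \<alpha> @ \<beta>" for \<alpha> \<beta>
    using assms that by (auto simp: blocks_def strict_mono_on_less)
  then show ?thesis
    unfolding decomposable_def map_eq_append_conv by (metis map_append)
qed

text \<open>If the cuts differed, the shorter left block and the letters between the two cuts would
  decompose the longer left block.\<close>

lemma blocks_indecomposable_unique:
  assumes "blocks r \<alpha> \<beta>" "blocks r \<alpha>' \<beta>'" "\<not> decomposable r \<alpha>" "\<not> decomposable r \<alpha>'"
    and "\<alpha> @ \<beta> = \<alpha>' @ \<beta>'"
  shows "\<alpha> = \<alpha>' \<and> \<beta> = \<beta>'"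
proof -
  have aux: "us = []" if "blocks r \<gamma> (us @ \<delta>)" "\<not> decomposable r (\<gamma> @ us)" for \<gamma> us \<delta>
    using that decomposableI[of r \<gamma> us] by (auto simp: blocks_def)
  from assms(5) obtain us where "\<alpha> = \<alpha>' @ us \<and> us @ \<beta> = \<beta>' \<or> \<alpha> @ us = \<alpha>' \<and> \<beta> = us @ \<beta>'"
    unfolding append_eq_append_conv2 by blast
  then show ?thesis
    using aux[of \<alpha>' us \<beta>] aux[of \<alpha> us \<beta>'] assms(1-4) by auto
qed

section \<open>Separable arrangements of an initial interval as sums of two blocks\<close>

definition sep :: "nat list \<Rightarrow> bool" where
  "sep xs \<longleftrightarrow> xs \<noteq> [] \<and> \<not> has_2413_3142 xs"

lemma sep_map: "strict_mono_on (set xs) g \<Longrightarrow> sep (map g xs) \<longleftrightarrow> sep xs"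
  by (simp add: sep_def has_2413_3142_map)

definition left_letters :: "(nat \<Rightarrow> nat \<Rightarrow> bool) \<Rightarrow> nat \<Rightarrow> nat \<Rightarrow> nat set" where
  "left_letters r n k = (if r = (<) then {..<k} else {n - k..<n})"

lemma greater_neq_less: "((>) :: nat \<Rightarrow> nat \<Rightarrow> bool) \<noteq> (<)"
  by (metis lessI not_less_iff_gr_or_eq)

lemma left_letters_unique:
  assumes r: "r = (<) \<or> r = (>)" and "I \<union> J = {..<n}" "\<forall>i\<in>I. \<forall>j\<in>J. r i j"
  shows "I = left_letters r n (card I)" "J = {..<n} - I"
proof -
  have "I = left_letters r n (card I) \<and> J = {..<n} - I"
  proof (cases "r = (<)")
    case True
    then have "\<forall>i\<in>I. \<forall>j\<in>J. i < j"
      using assms(3) by simp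
    note I = lower_set_partition[OF assms(2) this]
    have "{..<n} - {..<card I} = {card I..<n}"
      by auto
    then show ?thesis
      using True I unfolding left_letters_def by metis
  next
    case False
    then have "\<forall>j\<in>J. \<forall>i\<in>I. j < i"
      using r assms(3) by auto
    \<comment> \<open>In a skew sum it is the right block that forms the initial interval.\<close>
    moreover have un: "J \<union> I = {..<n}"
      using assms(2) by (simp add: Un_commute)
    ultimately obtain k where J: "J = {..<k}" "I = {k..<n}"
      using lower_set_partition[of J I n] by metis
    have "{..<k} \<subseteq> {..<n}"
      using un unfolding J by (metis Un_upper1)
    then have "n - card I = k" "{..<n} - I = J"
      unfolding J by auto
    then show ?thesis
      using False J(2) unfolding left_letters_def by simp
  qed
  then show "I = left_letters r n (card I)" "J = {..<n} - I"
    by simp_all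
qed

lemma left_letters_props:
  assumes "r = (<) \<or> r = (>)" "k \<le> n"
  shows "left_letters r n k \<subseteq> {..<n}" "card (left_letters r n k) = k"
    "\<And>a b. a \<in> left_letters r n k \<Longrightarrow> b \<in> {..<n} - left_letters r n k \<Longrightarrow> r a b"
  using assms greater_neq_less by (auto simp: left_letters_def split: if_splits)

lemma bij_betw_sep_decomposable:
  assumes r: "r = (<) \<or> r = (>)"
  shows "bij_betw (\<lambda>(k, \<alpha>, \<beta>). \<alpha> @ \<beta>)
    (SIGMA k:{1..<n}. arrangements (\<lambda>xs. sep xs \<and> \<not> decomposable r xs) (left_letters r n k) \<times>
       arrangements sep ({..<n} - left_letters r n k))
    (arrangements (\<lambda>xs. sep xs \<and> decomposable r xs) {..<n})" (is "bij_betw ?f ?D ?E")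
proof -
  have D: "blocks r \<alpha> \<beta>" "\<not> decomposable r \<alpha>" "sep \<alpha>" "sep \<beta>" "distinct (\<alpha> @ \<beta>)"
    "set (\<alpha> @ \<beta>) = {..<n}" "k = length \<alpha>"
    if "(k, \<alpha>, \<beta>) \<in> ?D" for k \<alpha> \<beta>
  proof -
    have "k \<le> n" using that by auto
    note L = left_letters_props[OF r this]
    show *: "\<not> decomposable r \<alpha>" "sep \<alpha>" "sep \<beta>"
      using that by (auto simp: arrangements_def)
    have set: "set \<alpha> = left_letters r n k" "set \<beta> = {..<n} - left_letters r n k" "distinct \<alpha>" "distinct \<beta>"
      using that by (auto simp: arrangements_def)
    show "blocks r \<alpha> \<beta>"
      using *(2,3) L(3) unfolding blocks_def set sep_def by blast
    show "distinct (\<alpha> @ \<beta>)" "set (\<alpha> @ \<beta>) = {..<n}"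
      using set L(1) by auto
    show "k = length \<alpha>"
      using distinct_card[OF set(3)] L(2) set(1) by simp
  qed
  show ?thesis
    unfolding bij_betw_def
  proof (intro conjI inj_onI set_eqI iffI)
    fix u v assume uv: "u \<in> ?D" "v \<in> ?D" "?f u = ?f v"
    obtain k \<alpha> \<beta> where u: "u = (k, \<alpha>, \<beta>)" by (cases u)
    obtain k' \<alpha>' \<beta>' where v: "v = (k', \<alpha>', \<beta>')" by (cases v)
    note Du = D[OF uv(1)[unfolded u]] and Dv = D[OF uv(2)[unfolded v]]
    have "\<alpha> @ \<beta> = \<alpha>' @ \<beta>'"
      using uv(3) by (simp add: u v)
    then show "u = v"
      using blocks_indecomposable_unique[OF Du(1) Dv(1) Du(2) Dv(2)] Du(7) Dv(7) by (simp add: u v)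
  next
    fix xs assume "xs \<in> ?f ` ?D"
    then obtain v where v: "v \<in> ?D" "xs = ?f v"
      by blast
    obtain k \<alpha> \<beta> where "v = (k, \<alpha>, \<beta>)" by (cases v)
    with v have u: "(k, \<alpha>, \<beta>) \<in> ?D" and xs: "xs = \<alpha> @ \<beta>"
      by simp_all
    note * = D[OF u]
    show "xs \<in> ?E"
      using * decomposableI[OF *(1)] has_2413_3142_append[OF r *(1)]
      unfolding xs arrangements_def sep_def by simp
  next
    fix xs assume "xs \<in> ?E"
    then have xs: "distinct xs" "set xs = {..<n}" "sep xs" "decomposable r xs"
      by (auto simp: arrangements_def)
    from xs(4) obtain \<alpha> \<beta> where bl: "blocks r \<alpha> \<beta>" and eq: "xs = \<alpha> @ \<beta>" and nd: "\<not> decomposable r \<alpha>"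
      by (rule decomposable_shortest)
    have un: "set \<alpha> \<union> set \<beta> = {..<n}"
      using xs(2) eq by simp
    have "\<forall>a\<in>set \<alpha>. \<forall>b\<in>set \<beta>. r a b"
      using bl by (simp add: blocks_def)
    note L = left_letters_unique[OF r un this]
    have "sep \<alpha>" "sep \<beta>"
      using xs(3) bl has_2413_3142_append[OF r bl] unfolding eq sep_def blocks_def by blast+
    moreover have dist: "distinct \<alpha>" "distinct \<beta>"
      using xs(1) eq by simp_all
    moreover have "length xs = n"
      using distinct_card[OF xs(1)] xs(2) by simp
    then have "card (set \<alpha>) \<in> {1..<n}"
      using bl eq distinct_card[OF dist(1)] by (cases \<alpha>; cases \<beta>) (auto simp: blocks_def)
    moreover have "set \<beta> = {..<n} - left_letters r n (card (set \<alpha>))"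
      using L by metis
    ultimately have "(card (set \<alpha>), \<alpha>, \<beta>) \<in> ?D"
      using nd L(1) by (simp add: arrangements_def)
    then show "xs \<in> ?f ` ?D"
      by (rule rev_image_eqI) (simp add: eq)
  qed
qed

section \<open>The generating functions coincide\<close>

text \<open>Subtracting the two equations leaves a multiple of \<open>F - G\<close>. The cofactor
  has constant term 1, since F, G and z have none, and power series over an integral domain have no
  zero divisors.\<close>

lemma fps_cubic_unique:
  fixes F G x y z :: "'a::idom fps"
  assumes "F = z + y * z * F + x * z * F ^ 2 + x * F ^ 3" "G = z + y * z * G + x * z * G ^ 2 + x * G ^ 3"
    and "F $ 0 = 0" "G $ 0 = 0" "z $ 0 = 0"
  shows "F = G"
proof -
  let ?u = "1 - y * z - x * z * (F + G) - x * (F ^ 2 + F * G + G ^ 2)"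
  have "(F - G) * ?u = 0"
    using assms(1,2) by algebra
  moreover have "?u $ 0 = 1"
    using assms by (simp add: fps_mult_nth_0 power2_eq_square)
  then have "?u \<noteq> 0"
    by (metis fps_zero_nth zero_neq_one)
  ultimately show ?thesis
    by simp
qed

text \<open>Here \<open>t = 1 - g\<close> and \<open>w = 1 - x q\<close> are the inverses of \<open>1 + G\<close> and \<open>1 + x H\<close>.\<close>

lemma separable_system_cubic:
  fixes F K G H p g q k x y z :: "'a::idom"
  assumes "z \<noteq> 0"
    and p: "p = F - p * G" and g: "g = G - g * G" and q: "q = H - x * q * H" and k: "k = K - x * k * H"
    and F: "F = z + p * G + x * q * F" and K: "K = z + g * K + x * k * H"
    and G: "G = z + g * G + x * k * F" and H: "H = z * y + p * K + x * q * H"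
  shows "F = z + (1 + x * y) * z * F + x * z * F ^ 2 + x * F ^ 3"
proof -
  define t w where "t = 1 - g" and "w = 1 - x * q"
  have t: "t * (1 + G) = 1" and w: "w * (1 + x * H) = 1"
    using g q unfolding t_def w_def by algebra+
  have "p * (1 + G) = F" "g * (1 + G) = G" "q * (1 + x * H) = H" "k * (1 + x * H) = K"
    using p g q k by algebra+
  moreover have "c = a * b" if "a * d = 1" "c * d = b" for a b c d :: 'a
    using that by (metis mult.left_commute mult.right_neutral mult.commute)
  ultimately have p': "p = t * F" and g': "g = t * G" and q': "q = w * H" and k': "k = w * K"
    using t w by blast+
  have tG: "t * G = 1 - t" and wH: "x * (w * H) = 1 - w"
    using t w by algebra+
  \<comment> \<open>In the application F and K have the flags \<open>True\<close>,
    \<open>False\<close> and \<open>False\<close>, \<open>True\<close>, which reverse-complementing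
    words interchanges. Their equality is obtained here from the algebra: both solve the same linear
    equation.\<close>
  have FK: "F * (t + w - 1) = z" "K * (t + w - 1) = z"
    using F K tG wH unfolding p' g' q' k' by algebra+
  then have "t + w - 1 \<noteq> 0"
    using \<open>z \<noteq> 0\<close> by (metis mult_zero_right)
  moreover have "(F - K) * (t + w - 1) = 0"
    by (simp only: left_diff_distrib FK diff_self)
  ultimately have "F = K" by simp
  have 1: "1 - t = z + x * w * F ^ 2"
    using G tG unfolding g' k' \<open>F = K\<close>[symmetric] by algebra
  have "w * H = z * y + t * F ^ 2"
    using H wH unfolding p' q' \<open>F = K\<close>[symmetric] by algebra
  then have 2: "1 - w = x * z * y + x * t * F ^ 2"
    using wH by algebra
  \<comment> \<open>\<open>FK(1)\<close> reads F = z + (1 - t) F + (1 - w) F. Inserting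
    \<open>1\<close> and \<open>2\<close> produces x (t + w) F^3, and (t + w) F = F + z splits it
    into the quadratic and the cubic term.\<close>
  show ?thesis
    using 1 2 FK(1) by algebra
qed

section \<open>The system of series for separable words\<close>

definition sep_sum :: "bool \<Rightarrow> bool \<Rightarrow> nat \<Rightarrow> int poly poly" where
  "sep_sum l e n = (\<Sum>xs\<in>arrangements sep {..<n}. weight l xs e)"

definition sep_dec_sum :: "(nat \<Rightarrow> nat \<Rightarrow> bool) \<Rightarrow> bool \<Rightarrow> bool \<Rightarrow> nat \<Rightarrow> int poly poly" where
  "sep_dec_sum r l e n = (\<Sum>xs\<in>arrangements (\<lambda>xs. sep xs \<and> decomposable r xs) {..<n}. weight l xs e)"

lemma sum_sep_indecomposable:
  "(\<Sum>xs\<in>arrangements (\<lambda>xs. sep xs \<and> \<not> decomposable r xs) {..<n}. weight l xs e) =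
     sep_sum l e n - sep_dec_sum r l e n"
proof -
  have "arrangements (\<lambda>xs. sep xs \<and> \<not> decomposable r xs) {..<n} =
      arrangements sep {..<n} - arrangements (\<lambda>xs. sep xs \<and> decomposable r xs) {..<n}"
    by (auto simp: arrangements_def)
  moreover have "arrangements (\<lambda>xs. sep xs \<and> decomposable r xs) {..<n} \<subseteq> arrangements sep {..<n}"
    by (auto simp: arrangements_def)
  ultimately show ?thesis
    unfolding sep_sum_def sep_dec_sum_def by (simp add: sum_diff)
qed

text \<open>\<open>d\<close> says whether the seam is a descent, and so it is both the right flag of
  the left block and the left flag of the right block. The difference of sums accounts for the left
  block being indecomposable.\<close>

lemma sep_dec_sum_conv:
  assumes r: "r = (<) \<and> d = False \<or> r = (>) \<and> d = True"
  shows "sep_dec_sum r l e n =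
    (\<Sum>k=1..<n. (sep_sum l d k - sep_dec_sum r l d k) * (if d then X else 1) * sep_sum d e (n - k))"
proof -
  let ?L = "\<lambda>k. arrangements (\<lambda>xs. sep xs \<and> \<not> decomposable r xs) (left_letters r n k)"
  let ?R = "\<lambda>k. arrangements sep ({..<n} - left_letters r n k)"
  have r': "r = (<) \<or> r = (>)"
    using r by blast
  have fin: "finite (left_letters r n k)" for k
    by (simp add: left_letters_def)
  have "sep_dec_sum r l e n = (\<Sum>(k, \<alpha>, \<beta>)\<in>(SIGMA k:{1..<n}. ?L k \<times> ?R k). weight l (\<alpha> @ \<beta>) e)"
    unfolding sep_dec_sum_def
    by (subst sum.reindex_bij_betw[OF bij_betw_sep_decomposable[OF r'], symmetric]) (simp add: case_prod_unfold)
  also have "\<dots> = (\<Sum>k=1..<n. \<Sum>(\<alpha>, \<beta>)\<in>?L k \<times> ?R k. weight l (\<alpha> @ \<beta>) e)"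
    by (subst sum.Sigma) (simp_all add: fin)
  also have "\<dots> = (\<Sum>k=1..<n. (sep_sum l d k - sep_dec_sum r l d k) * (if d then X else 1) * sep_sum d e (n - k))"
  proof (rule sum.cong[OF refl])
    fix k assume "k \<in> {1..<n}"
    then have "k \<le> n" by simp
    note L = left_letters_props[OF r' this]
    have w: "weight l (\<alpha> @ \<beta>) e = weight l \<alpha> d * (if d then X else 1) * weight d \<beta> e"
      if "\<alpha> \<in> ?L k" "\<beta> \<in> ?R k" for \<alpha> \<beta>
    proof -
      have ne: "\<alpha> \<noteq> []" "\<beta> \<noteq> []"
        using that by (auto simp: arrangements_def sep_def)
      have "last \<alpha> \<in> left_letters r n k" "hd \<beta> \<in> {..<n} - left_letters r n k"
        using last_in_set[OF ne(1)] hd_in_set[OF ne(2)] that by (simp_all add: arrangements_def)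
      then have "r (last \<alpha>) (hd \<beta>)"
        by (rule L(3))
      then have "(hd \<beta> < last \<alpha>) = d"
        using r by auto
      then show ?thesis
        using ne by (simp add: weight_append Let_def)
    qed
    have "(\<Sum>(\<alpha>, \<beta>)\<in>?L k \<times> ?R k. weight l (\<alpha> @ \<beta>) e)
        = (\<Sum>\<alpha>\<in>?L k. \<Sum>\<beta>\<in>?R k. weight l \<alpha> d * (if d then X else 1) * weight d \<beta> e)"
      unfolding sum.cartesian_product[symmetric] by (intro sum.cong refl w)
    also have "\<dots> = (\<Sum>\<alpha>\<in>?L k. weight l \<alpha> d) * (if d then X else 1) * (\<Sum>\<beta>\<in>?R k. weight d \<beta> e)"
      by (simp only: sum_distrib_left[symmetric] sum_distrib_right[symmetric])
    also have "(\<Sum>\<alpha>\<in>?L k. weight l \<alpha> d) = sep_sum l d k - sep_dec_sum r l d k"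
      unfolding sum_sep_indecomposable[symmetric]
      by (subst sum_arrangements_card[OF fin]) (simp_all add: sep_map decomposable_map[OF r'] weight_map L(2))
    also have "(\<Sum>\<beta>\<in>?R k. weight d \<beta> e) = sep_sum d e (n - k)"
      unfolding sep_sum_def
      by (subst sum_arrangements_card) (simp_all add: sep_map weight_map card_Diff_subset[OF fin L(1)] L(2))
    finally show "(\<Sum>(\<alpha>, \<beta>)\<in>?L k \<times> ?R k. weight l (\<alpha> @ \<beta>) e)
        = (sep_sum l d k - sep_dec_sum r l d k) * (if d then X else 1) * sep_sum d e (n - k)" .
  qed
  finally show ?thesis .
qed

lemma arrangements_sep_small:
  "arrangements sep {} = {}" "arrangements sep {..<Suc 0} = {[0]}"
proof -
  show "arrangements sep {} = {}"
    by (auto simp: arrangements_def sep_def)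
  show "arrangements sep {..<Suc 0} = {[0]}"
  proof (intro set_eqI iffI)
    fix xs assume "xs \<in> arrangements sep {..<Suc 0}"
    then have xs: "distinct xs" "set xs = {0}"
      by (simp_all add: arrangements_def lessThan_Suc)
    then have "length xs = 1"
      using distinct_card[OF xs(1)] by simp
    then obtain a where "xs = [a]"
      by (cases xs) simp_all
    with xs(2) show "xs \<in> {[0]}" by simp
  next
    fix xs :: "nat list" assume "xs \<in> {[0]}"
    then show "xs \<in> arrangements sep {..<Suc 0}"
      by (simp add: arrangements_def sep_def has_2413_3142_def occurs_def lessThan_Suc)
  qed
qed

lemma sep_sum_split:
  "sep_sum l e n = (if n = 1 then if l \<and> e then Y else 1 else 0) + sep_dec_sum (<) l e n + sep_dec_sum (>) l e n"
proof -
  let ?A = "\<lambda>P. arrangements (\<lambda>xs. sep xs \<and> P xs) {..<n}"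
  let ?I = "?A (\<lambda>xs. \<not> decomposable (<) xs \<and> \<not> decomposable (>) xs)"
  have "\<not> (decomposable (<) xs \<and> decomposable (>) xs)" for xs :: "nat list"
    using decomposable_hd_last[of "(<)" xs] decomposable_hd_last[of "(>)" xs] by auto
  then have disj: "?A (decomposable (<)) \<inter> ?A (decomposable (>)) = {}"
    by (auto simp: arrangements_def)
  have un: "arrangements sep {..<n} = ?I \<union> (?A (decomposable (<)) \<union> ?A (decomposable (>)))"
    and disj': "?I \<inter> (?A (decomposable (<)) \<union> ?A (decomposable (>))) = {}"
    by (auto simp: arrangements_def)
  have I: "?I = (if n = 1 then {[0]} else {})"
  proof -
    have "length xs = n" if "xs \<in> arrangements sep {..<n}" for xs
      using length_arrangements[OF that] by simp
    moreover have "xs \<in> arrangements sep {..<n} \<and> \<not> decomposable (<) xs \<and> \<not> decomposable (>) xs \<longleftrightarrow> xs \<in> ?I" for xs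
      by (auto simp: arrangements_def)
    moreover have "length xs \<le> 1 \<longleftrightarrow> \<not> decomposable (<) xs \<and> \<not> decomposable (>) xs"
      if "xs \<in> arrangements sep {..<n}" for xs
      using that separable_decomposable[of xs] decomposable_length[of "(<)" xs] decomposable_length[of "(>)" xs]
      by (force simp: arrangements_def sep_def)
    ultimately have "?I = (if n \<le> 1 then arrangements sep {..<n} else {})"
      by (intro set_eqI) (metis empty_iff)
    also have "\<dots> = (if n = 1 then {[0]} else {})"
      using arrangements_sep_small by (auto simp: le_Suc_eq)
    finally show ?thesis .
  qed
  show ?thesis
    unfolding sep_sum_def sep_dec_sum_def un
    by (subst sum.union_disjoint[OF _ _ disj'], simp, simp, subst sum.union_disjoint[OF _ _ disj])
      (simp_all add: I)
qed

lemma sep_fps_cubic: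
  fixes F x y z :: "int poly poly fps"
  defines "F \<equiv> Abs_fps (sep_sum True False)" and "z \<equiv> fps_X" and "x \<equiv> fps_const X" and "y \<equiv> fps_const Y"
  shows "F = z + (1 + x * y) * z * F + x * z * F ^ 2 + x * F ^ 3"
proof -
  define E P M where "E l e = Abs_fps (sep_sum l e)" and "P l e = Abs_fps (sep_dec_sum (<) l e)"
    and "M l e = Abs_fps (sep_dec_sum (>) l e)" for l e
  have zero: "sep_sum l e 0 = 0" "sep_dec_sum r l e 0 = 0" for l e r
    using arrangements_sep_small by (auto simp: sep_sum_def sep_dec_sum_def arrangements_def decomposable_def blocks_def)
  have init: "E l e $ 0 = 0" "(E l e - P l e) $ 0 = 0" "(x * (E l e - M l e)) $ 0 = 0" for l e
    by (simp_all add: E_def P_def M_def zero)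
  have P: "P l e = (E l False - P l False) * E False e" for l e
    by (rule fps_ext, subst fps_mult_nth_Suc_interior[OF init(2,1)])
      (simp add: E_def P_def sep_dec_sum_conv[of "(<)" False] del: sum.op_ivl_Suc)
  have M: "M l e = x * (E l True - M l True) * E True e" for l e
    by (rule fps_ext, subst fps_mult_nth_Suc_interior[OF init(3,1)])
      (simp add: E_def M_def x_def sep_dec_sum_conv[of "(>)" True] mult_ac del: sum.op_ivl_Suc)
  have E: "E l e = z * (if l \<and> e then y else 1) + P l e + M l e" for l e
  proof (rule fps_ext)
    fix n
    have "(z * (if l \<and> e then y else 1)) $ n = (if n = 1 then if l \<and> e then Y else 1 else 0)"
      by (simp add: z_def y_def fps_X_def)
    then show "E l e $ n = (z * (if l \<and> e then y else 1) + P l e + M l e) $ n"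
      using sep_sum_split[of l e n] by (simp add: E_def P_def M_def)
  qed
  have "z \<noteq> 0"
    by (simp add: z_def)
  have F: "F = E True False"
    by (simp add: F_def E_def)
  show ?thesis
    unfolding F
  \<comment> \<open>Each small letter has the flags of its capital, with p going with F; p and g
    belong to words that are no direct sum, q and k to words that are no skew sum.\<close>
  proof (rule separable_system_cubic[where K = "E False True" and G = "E False False" and H = "E True True"
        and p = "E True False - P True False" and g = "E False False - P False False"
        and q = "E True True - M True True" and k = "E False True - M False True"])
  qed (simp_all only: P[symmetric] M[symmetric],
      use \<open>z \<noteq> 0\<close> E[of True False] E[of False True] E[of False False] E[of True True] in simp_all)
qed

lemma av_sum_eq_sep_sum: "av_sum n = sep_sum True False n"
proof -
  have zero: "av_sum 0 = 0" "sep_sum True False 0 = 0"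
    using arrangements_sep_small by (simp_all add: av_sum_def sep_sum_def)
  have "Abs_fps av_sum = Abs_fps (sep_sum True False)"
    by (rule fps_cubic_unique[OF av_fps_cubic sep_fps_cubic]) (simp_all add: zero)
  then show ?thesis
    by (metis fps_nth_Abs_fps)
qed

section \<open>Reading off coefficients, and the theorem\<close>

lemma X_Y_coeff: "coeff (coeff (X ^ i * Y ^ j) k) m = (if k = i \<and> m = j then 1 else 0)"
proof -
  have "X ^ i = monom 1 i" "Y ^ j = monom (monom 1 j) 0"
    by (simp_all add: X_def Y_def monom_altdef poly_const_pow one_pCons[symmetric] flip: smult_power)
  then show ?thesis
    by (simp add: mult_monom)
qed

lemma coeff_sum_X_Y:
  assumes "finite A"
  shows "coeff (coeff (\<Sum>\<pi>\<in>A. X ^ des n \<pi> * Y ^ dd n \<pi>) k) m =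
    int (card {\<pi> \<in> A. dd n \<pi> = m \<and> des n \<pi> = k})"
proof -
  have "coeff (coeff (\<Sum>\<pi>\<in>A. X ^ des n \<pi> * Y ^ dd n \<pi>) k) m =
      (\<Sum>\<pi>\<in>A. if dd n \<pi> = m \<and> des n \<pi> = k then 1 else 0)"
    by (simp add: coeff_sum X_Y_coeff) (intro sum.cong refl, auto)
  also have "\<dots> = int (card {\<pi> \<in> A. dd n \<pi> = m \<and> des n \<pi> = k})"
    using assms by (simp add: sum.If_cases Int_def)
  finally show ?thesis .
qed

lemma finite_avoiders: "finite (avoiders n \<Sigma>)"
  by (rule finite_subset[OF _ finite_permutations[of "{1..n}"]]) (auto simp: avoiders_def)

theorem theorem3:
  fixes n :: nat
  assumes "n \<ge> 1"
  shows "(\<Sum>\<pi>\<in>avoiders n {[3,4,1,2], [3,4,2,1]}. X ^ des n \<pi> * Y ^ dd n \<pi>)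
           = (\<Sum>\<pi>\<in>avoiders n {[2,4,1,3], [3,1,4,2]}. X ^ des n \<pi> * Y ^ dd n \<pi>)
         \<and> (\<forall>m k. card {\<pi> \<in> avoiders n {[3,4,1,2], [3,4,2,1]}. dd n \<pi> = m \<and> des n \<pi> = k}
                 = card {\<pi> \<in> avoiders n {[2,4,1,3], [3,1,4,2]}. dd n \<pi> = m \<and> des n \<pi> = k})"
proof -
  have ne: "word n \<pi> \<noteq> []" for \<pi> :: "nat \<Rightarrow> nat"
    using assms by (simp add: word_def del: upt_Suc)
  have "(\<Sum>\<pi>\<in>avoiders n {[3,4,1,2], [3,4,2,1]}. X ^ des n \<pi> * Y ^ dd n \<pi>) = av_sum n"
    unfolding av_sum_def
    by (rule sum_avoiders_eq_arrangements[OF assms _ av_map]) (simp only: avoids_3412_3421_iff av_def ne simp_thms)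
  moreover have "(\<Sum>\<pi>\<in>avoiders n {[2,4,1,3], [3,1,4,2]}. X ^ des n \<pi> * Y ^ dd n \<pi>) = sep_sum True False n"
    unfolding sep_sum_def
    by (rule sum_avoiders_eq_arrangements[OF assms _ sep_map]) (simp only: avoids_2413_3142_iff sep_def ne simp_thms)
  ultimately have eq: "(\<Sum>\<pi>\<in>avoiders n {[3,4,1,2], [3,4,2,1]}. X ^ des n \<pi> * Y ^ dd n \<pi>)
      = (\<Sum>\<pi>\<in>avoiders n {[2,4,1,3], [3,1,4,2]}. X ^ des n \<pi> * Y ^ dd n \<pi>)"
    by (simp only: av_sum_eq_sep_sum)
  have "card {\<pi> \<in> avoiders n {[3,4,1,2], [3,4,2,1]}. dd n \<pi> = m \<and> des n \<pi> = k}
      = card {\<pi> \<in> avoiders n {[2,4,1,3], [3,1,4,2]}. dd n \<pi> = m \<and> des n \<pi> = k}" for m k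
    using arg_cong[OF eq, of "\<lambda>p. coeff (coeff p k) m"]
    unfolding coeff_sum_X_Y[OF finite_avoiders] of_nat_eq_iff .
  with eq show ?thesis by blast
qed

end
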